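(* Let $a\ge0$ be an integer and let $p\in(0,1)$. Then $$\omega\left(\mathbf{EMaMu}\bigl(2,2,a^{\frac{1-p}{p}};\,a+2\bigr)\right)\le\frac1p\Bigl[\log\bigl(4(a+2)+1\bigr)-h(p)\Bigr],$$ where $h(p)=-p\log(p)-(1-p)\log(1-p)$ and $\log=\log_2$.
   Context: All vector spaces are finite dimensional over $\mathbb{C}$. For a tensor $T\in V_1\otimes\cdots\otimes V_k$, the tensor rank $\mathrm{R}(T)$ is the least $r$ such that $T$ is a sum of $r$ tensors of the form $v_1\otimes\cdots\otimes v_k$. The border rank $\underline{\mathrm{R}}(T)$ is the least $r$ such that $T$ is a limit (Euclidean topology) of tensors of rank $r$. The Kronecker product $T\boxtimes S\in(V_1\otimes W_1)\otimes\cdots\otimes(V_k\otimes W_k)$ of $T\in V_1\otimes\cdots\otimes V_k$ and $S\in W_1\otimes\cdots\otimes W_k$ is $T\otimes S$ regrouped as a $k$-tensor. The asymptotic rank is $\lim_{N\to\infty}\mathrm{R}(T^{\boxtimes N})^{1/N}$ (the same value is obtained with $\underline{\mathrm{R}}$ in place of $\mathrm{R}$), and the exponent $\omega(T)$ is its base-2 logarithm. For integers $n_1,n_2,n_3,n_4$, the extended matrix multiplication tensor is the 4-tensor $$\mathbf{EMaMu}(n_1,n_2,n_3;n_4)=\sum_{i_1=1}^{n_1}\sum_{i_2=1}^{n_2}\sum_{i_3=1}^{n_3}\sum_{i_4=1}^{n_4} e_{i_1,i_3}\otimes e_{i_2,i_3}\otimes e_{i_4}\otimes e_{i_1,i_2,i_4}\in\mathbb{C}^{n_1n_3}\otimes\mathbb{C}^{n_2n_3}\otimes\mathbb{C}^{n_4}\otimes\mathbb{C}^{n_1n_2n_4},$$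 where the $e$'s denote basis vectors of the respective factors. It is the graph tensor on vertices $1,2,3,4$ with edges $\{1,4\},\{2,4\},\{1,2\},\{3,4\}$ of weights $n_1,n_2,n_3,n_4$ respectively. It satisfies $\mathbf{EMaMu}(n_1,n_2,n_3;n_4)^{\boxtimes N}=\mathbf{EMaMu}(n_1^N,n_2^N,n_3^N;n_4^N)$ up to change of bases. Convention for non-integer weights: for nonnegative real weights, the statement $\omega(\mathbf{EMaMu}(n_1,n_2,n_3;n_4))\le\lambda$ means that $\underline{\mathrm{R}}(\mathbf{EMaMu}(n_1^N,n_2^N,n_3^N;n_4^N))\le 2^{\lambda N+o(N)}$, where $N$ ranges over the positive integers for which all of $n_1^N,n_2^N,n_3^N,n_4^N$ are integers. *)

theory Defs
  imports "HOL-Analysis.Analysis" "HOL-Library.Landau_Symbols"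
begin

text \<open>
  The space of coordinate vectors indexed by \<open>I\<close>, as functions vanishing outside \<open>I\<close>.
  For finite \<open>A\<close>, \<open>B\<close>, \<open>C\<close>, \<open>D\<close>, the tensor product of the coordinate spaces of
  \<open>A\<close>, \<open>B\<close>, \<open>C\<close> and \<open>D\<close> is \<open>coord_space (A \<times> B \<times> C \<times> D)\<close>.
\<close>

definition coord_space :: "'a set \<Rightarrow> ('a \<Rightarrow> complex) set" where
  "coord_space I = {v. \<forall>i. i \<notin> I \<longrightarrow> v i = 0}"

definition basis_vec :: "'a \<Rightarrow> 'a \<Rightarrow> complex" where
  "basis_vec i = (\<lambda>j. if j = i then 1 else 0)"

definition tensor4 ::
  "('a \<Rightarrow> complex) \<Rightarrow> ('b \<Rightarrow> complex) \<Rightarrow> ('c \<Rightarrow> complex) \<Rightarrow> ('d \<Rightarrow> complex)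
    \<Rightarrow> 'a \<times> 'b \<times> 'c \<times> 'd \<Rightarrow> complex" where
  "tensor4 u v w z = (\<lambda>(a, b, c, d). u a * v b * w c * z d)"

definition tensor_rank ::
  "'a set \<Rightarrow> 'b set \<Rightarrow> 'c set \<Rightarrow> 'd set \<Rightarrow> ('a \<times> 'b \<times> 'c \<times> 'd \<Rightarrow> complex) \<Rightarrow> nat" where
  "tensor_rank A B C D T = (LEAST r. \<exists>u v w z.
      (\<forall>l<r. u l \<in> coord_space A \<and> v l \<in> coord_space B \<and>
             w l \<in> coord_space C \<and> z l \<in> coord_space D) \<and>
      T = (\<lambda>x. \<Sum>l<r. tensor4 (u l) (v l) (w l) (z l) x))"

text \<open>
  The limit is taken in the product topology on functions; on the finite-dimensional space
  \<open>coord_space (A \<times> B \<times> C \<times> D)\<close> it induces the Euclidean topology.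
\<close>

definition border_rank ::
  "'a set \<Rightarrow> 'b set \<Rightarrow> 'c set \<Rightarrow> 'd set \<Rightarrow> ('a \<times> 'b \<times> 'c \<times> 'd \<Rightarrow> complex) \<Rightarrow> nat" where
  "border_rank A B C D T = (LEAST r. \<exists>S :: nat \<Rightarrow> 'a \<times> 'b \<times> 'c \<times> 'd \<Rightarrow> complex.
      (\<forall>n. S n \<in> coord_space (A \<times> B \<times> C \<times> D) \<and> tensor_rank A B C D (S n) = r) \<and>
      S \<longlonglongrightarrow> T)"

definition EMaMu ::
  "nat \<Rightarrow> nat \<Rightarrow> nat \<Rightarrow> nat
    \<Rightarrow> (nat \<times> nat) \<times> (nat \<times> nat) \<times> nat \<times> (nat \<times> nat \<times> nat) \<Rightarrow> complex" where
  "EMaMu n1 n2 n3 n4 = (\<lambda>x. \<Sum>i1=1..n1. \<Sum>i2=1..n2. \<Sum>i3=1..n3. \<Sum>i4=1..n4.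
      tensor4 (basis_vec (i1, i3)) (basis_vec (i2, i3)) (basis_vec i4)
        (basis_vec (i1, i2, i4)) x)"

definition EMaMu_border_rank :: "nat \<Rightarrow> nat \<Rightarrow> nat \<Rightarrow> nat \<Rightarrow> nat" where
  "EMaMu_border_rank n1 n2 n3 n4 =
     border_rank ({1..n1} \<times> {1..n3}) ({1..n2} \<times> {1..n3}) {1..n4}
       ({1..n1} \<times> {1..n2} \<times> {1..n4}) (EMaMu n1 n2 n3 n4)"

text \<open>
  The assertion \<open>\<omega>(EMaMu(n1, n2, n3; n4)) \<le> b\<close> for nonnegative real weights.  It only
  constrains those \<open>N\<close> for which all \<open>N\<close>-th powers of the weights are integers;
  for these, \<open>nat \<lfloor>n ^ N\<rfloor>\<close> is \<open>n ^ N\<close> itself.  The error term \<open>f\<close> is given on all of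
  \<open>nat\<close>, but its values at the other \<open>N\<close> are irrelevant and may be taken to be 0.
\<close>

definition EMaMu_omega_le :: "real \<Rightarrow> real \<Rightarrow> real \<Rightarrow> real \<Rightarrow> real \<Rightarrow> bool" where
  "EMaMu_omega_le n1 n2 n3 n4 b \<longleftrightarrow>
     (\<exists>f :: nat \<Rightarrow> real. f \<in> o(\<lambda>N. real N) \<and>
       (\<forall>N>0. n1 ^ N \<in> \<int> \<and> n2 ^ N \<in> \<int> \<and> n3 ^ N \<in> \<int> \<and> n4 ^ N \<in> \<int> \<longrightarrow>
          real (EMaMu_border_rank (nat \<lfloor>n1 ^ N\<rfloor>) (nat \<lfloor>n2 ^ N\<rfloor>) (nat \<lfloor>n3 ^ N\<rfloor>) (nat \<lfloor>n4 ^ N\<rfloor>))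
            \<le> 2 powr (b * real N + f N)))"

definition binary_entropy :: "real \<Rightarrow> real" where
  "binary_entropy p = - p * log 2 p - (1 - p) * log 2 (1 - p)"

end

theory Submission
  imports Defs
begin

text \<open>
  The bound comes from one degeneration and one counting argument.

  The degeneration: a tensor of rank \<open>4 (a + 2)\<close>, namely \<open>EMaMu(2,2,1;a+2)\<close>, can be
  enlarged to the direct sum \<open>EMaMu(2,2,1;a+2) \<oplus> EMaMu(1,1,a;1)\<close> at the price of a single
  further rank-one tensor, in the sense of border rank (lemma \<open>border_rank_le_EMaMu_sum\<close>).
  The rank-one terms of the first summand are perturbed to order \<open>\<epsilon>\<close> in the first three factors, in
  such a way that the sum of these triple products differs from a single rank-one tensor only by an
  \<open>\<epsilon>\<^sup>3\<close> term, the second summand. A component of the fourth factor of size \<open>1 / \<epsilon>\<^sup>3\<close> selects this sum.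

  The counting: put \<open>R = 4 (a + 2) + 1\<close>. The \<open>N\<close>-th Kronecker power of a direct sum \<open>X \<oplus> Y\<close> contains,
  for \<open>k + l = N\<close>, as many disjoint copies of \<open>X^k \<boxtimes> Y^l\<close> as there are ways to place the \<open>k\<close>
  factors \<open>X\<close>. Hence \<open>N choose k\<close> copies of \<open>EMaMu(2^k, 2^k, a^l; (a+2)^k)\<close> have border rank at most
  \<open>R^N\<close> (lemma \<open>copies_border_rank_le_choose\<close>). As in Schoenhage's asymptotic sum
  inequality, if \<open>s\<close> copies of a tensor have border rank at most \<open>q s\<close>, then each Kronecker multiplication
  by the tensor costs only a factor \<open>q\<close> (lemma \<open>copies_border_rank_le_power\<close>), so asymptotically a
  single copy costs \<open>R^N / (N choose k)\<close>. For \<open>k\<close> close to \<open>p N\<close> this is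
  \<open>2 powr (N (log 2 R - h p) + o N)\<close>, and the exponents satisfy \<open>l / k \<approx> (1 - p) / p\<close>. Measured per unit
  of \<open>k\<close>, this is the claimed exponent.

  All estimates are made for the closure of the set of tensors of rank at most \<open>r\<close>, which behaves well under
  continuous operations; the comparison with the least-number definition is made once, and supports
  are cut down to the coordinate spaces there. The index types are arbitrary in the meantime, so that
  sequences can be indices of Kronecker powers and sets can be labels of direct summands.
\<close>

section \<open>Border rank as membership in a closure\<close>

definition rank_le :: "nat \<Rightarrow> ('a \<times> 'b \<times> 'c \<times> 'd \<Rightarrow> complex) \<Rightarrow> bool" where
  "rank_le r T \<longleftrightarrow> (\<exists>u v w z. T = (\<lambda>x. \<Sum>l<r. tensor4 (u l) (v l) (w l) (z l) x))"

definition border_rank_le :: "nat \<Rightarrow> ('a \<times> 'b \<times> 'c \<times> 'd \<Rightarrow> complex) \<Rightarrow> bool" where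
  "border_rank_le r T \<longleftrightarrow> T \<in> closure {S. rank_le r S}"

lemma rank_le_sum_indexed:
  fixes u :: "'l \<Rightarrow> 'a \<Rightarrow> complex"
  assumes "finite L" "card L \<le> r"
  shows "rank_le r (\<lambda>x. \<Sum>l\<in>L. tensor4 (u l) (v l) (w l) (z l) x)"
proof -
  obtain h where h: "inj_on h L" "h ` L \<subseteq> {..<r}"
    using inj_on_iff_card_le[of L "{..<r}"] assms by auto
  define g where "g = inv_into L h"
  define u' where "u' = (\<lambda>l. if l \<in> h ` L then u (g l) else (\<lambda>_. 0))"
  have "(\<Sum>l<r. tensor4 (u' l) (v (g l)) (w (g l)) (z (g l)) x)
      = (\<Sum>l\<in>L. tensor4 (u l) (v l) (w l) (z l) x)" for x
  proof -
    have "(\<Sum>l<r. tensor4 (u' l) (v (g l)) (w (g l)) (z (g l)) x)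
        = (\<Sum>l\<in>h ` L. tensor4 (u (g l)) (v (g l)) (w (g l)) (z (g l)) x)"
      by (rule sum.mono_neutral_cong_right)
        (use h in \<open>auto simp: u'_def tensor4_def split: prod.splits\<close>)
    also have "\<dots> = (\<Sum>l\<in>L. tensor4 (u l) (v l) (w l) (z l) x)"
      using h(1) by (simp add: sum.reindex g_def)
    finally show ?thesis .
  qed
  then show ?thesis
    unfolding rank_le_def by (intro exI[of _ u'] exI[of _ "\<lambda>l. v (g l)"]
        exI[of _ "\<lambda>l. w (g l)"] exI[of _ "\<lambda>l. z (g l)"]) auto
qed

lemma rank_le_add:
  assumes "rank_le r T" "rank_le q S"
  shows "rank_le (r + q) (\<lambda>x. T x + S x)"
proof -
  obtain u v w z where T: "T = (\<lambda>x. \<Sum>l<r. tensor4 (u l) (v l) (w l) (z l) x)"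
    using assms(1) unfolding rank_le_def by blast
  obtain u' v' w' z' where S: "S = (\<lambda>x. \<Sum>l<q. tensor4 (u' l) (v' l) (w' l) (z' l) x)"
    using assms(2) unfolding rank_le_def by blast
  have "T x + S x = (\<Sum>l\<in>{..<r} <+> {..<q}. tensor4 (case_sum u u' l) (case_sum v v' l)
      (case_sum w w' l) (case_sum z z' l) x)" for x
    by (simp add: T S sum.Plus)
  then show ?thesis
    using rank_le_sum_indexed[of "{..<r} <+> {..<q}" "r + q"] by (simp add: card_Plus)
qed

lemma rank_le_tensor4: "rank_le 1 (tensor4 u v w z)"
  using rank_le_sum_indexed[of "{()}" 1 "\<lambda>_. u" "\<lambda>_. v" "\<lambda>_. w" "\<lambda>_. z"] by simp

lemma rank_le_mono:
  assumes "rank_le r T" "r \<le> q"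
  shows "rank_le q T"
proof -
  from assms(1) obtain u v w z where "T = (\<lambda>x. \<Sum>l<r. tensor4 (u l) (v l) (w l) (z l) x)"
    unfolding rank_le_def by blast
  with rank_le_sum_indexed[of "{..<r}" q u v w z] assms(2) show ?thesis by simp
qed

text \<open>
  Rank cannot grow under linear maps of the four factors. The matrices \<open>\<alpha>\<close>, \<open>\<beta>\<close>, \<open>\<gamma>\<close>, \<open>\<delta>\<close>
  of these maps are given with a range of summation that may depend on the target index; this covers
  reindexing along arbitrary functions between infinite index types.
\<close>

lemma rank_le_substitute:
  fixes \<alpha> :: "'a \<Rightarrow> 'a2 \<Rightarrow> complex" and \<beta> :: "'b \<Rightarrow> 'b2 \<Rightarrow> complex"
    and \<gamma> :: "'c \<Rightarrow> 'c2 \<Rightarrow> complex" and \<delta> :: "'d \<Rightarrow> 'd2 \<Rightarrow> complex"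
  assumes "rank_le r T"
  shows "rank_le r (\<lambda>(a, b, c, d). \<Sum>a'\<in>I a. \<Sum>b'\<in>J b. \<Sum>c'\<in>K c. \<Sum>d'\<in>L d.
           \<alpha> a a' * \<beta> b b' * \<gamma> c c' * \<delta> d d' * T (a', b', c', d'))"
proof -
  from assms obtain u v w z where T: "T = (\<lambda>x. \<Sum>l<r. tensor4 (u l) (v l) (w l) (z l) x)"
    unfolding rank_le_def by blast
  have "(\<Sum>a'\<in>I a. \<Sum>b'\<in>J b. \<Sum>c'\<in>K c. \<Sum>d'\<in>L d.
           \<alpha> a a' * \<beta> b b' * \<gamma> c c' * \<delta> d d' * T (a', b', c', d'))
      = (\<Sum>l<r. (\<Sum>a'\<in>I a. \<alpha> a a' * u l a') * (\<Sum>b'\<in>J b. \<beta> b b' * v l b')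
            * (\<Sum>c'\<in>K c. \<gamma> c c' * w l c') * (\<Sum>d'\<in>L d. \<delta> d d' * z l d'))" for a b c d
  proof -
    have 1: "\<alpha> a a' * \<beta> b b' * \<gamma> c c' * \<delta> d d' * T (a', b', c', d')
      = (\<Sum>l<r. (\<alpha> a a' * u l a') * (\<beta> b b' * v l b') * (\<gamma> c c' * w l c') * (\<delta> d d' * z l d'))"
      for a' b' c' d'
      by (simp add: T tensor4_def sum_distrib_left mult_ac)
    have 2: "(\<Sum>a'\<in>I a. A a') * (\<Sum>b'\<in>J b. B b') * (\<Sum>c'\<in>K c. C c') * (\<Sum>d'\<in>L d. D d')
      = (\<Sum>a'\<in>I a. \<Sum>b'\<in>J b. \<Sum>c'\<in>K c. \<Sum>d'\<in>L d. A a' * B b' * C c' * D d')"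
      for A B C D :: "_ \<Rightarrow> complex"
      by (simp only: sum_distrib_left[symmetric] sum_distrib_right[symmetric] mult.assoc)
    show ?thesis
      by (simp only: 1 2 sum.swap[where B = "{..<r}"])
  qed
  then show ?thesis
    unfolding rank_le_def
    by (intro exI[of _ "\<lambda>l a. \<Sum>a'\<in>I a. \<alpha> a a' * u l a'"]
        exI[of _ "\<lambda>l b. \<Sum>b'\<in>J b. \<beta> b b' * v l b'"]
        exI[of _ "\<lambda>l c. \<Sum>c'\<in>K c. \<gamma> c c' * w l c'"]
        exI[of _ "\<lambda>l d. \<Sum>d'\<in>L d. \<delta> d d' * z l d'"])
      (simp add: tensor4_def fun_eq_iff)
qed

text \<open>
  The pointwise product restricts the Kronecker product to the diagonal of the index sets. Conversely the
  Kronecker product is the pointwise product of two reindexed tensors, so this lemma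
  also serves for Kronecker products.
\<close>

lemma rank_le_mult:
  assumes "rank_le r T" "rank_le q S"
  shows "rank_le (r * q) (\<lambda>x. T x * S x)"
proof -
  obtain u v w z where T: "T = (\<lambda>x. \<Sum>l<r. tensor4 (u l) (v l) (w l) (z l) x)"
    using assms(1) unfolding rank_le_def by blast
  obtain u' v' w' z' where S: "S = (\<lambda>x. \<Sum>l<q. tensor4 (u' l) (v' l) (w' l) (z' l) x)"
    using assms(2) unfolding rank_le_def by blast
  have "T x * S x = (\<Sum>l\<in>{..<r} \<times> {..<q}. tensor4
      (\<lambda>a. u (fst l) a * u' (snd l) a) (\<lambda>b. v (fst l) b * v' (snd l) b)
      (\<lambda>c. w (fst l) c * w' (snd l) c) (\<lambda>d. z (fst l) d * z' (snd l) d) x)" for x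
    by (simp only: T S sum_product sum.cartesian_product) (simp add: tensor4_def case_prod_unfold mult_ac)
  then show ?thesis
    using rank_le_sum_indexed[of "{..<r} \<times> {..<q}" "r * q"] by simp
qed

lemma border_rank_leI: "rank_le r T \<Longrightarrow> border_rank_le r T"
  unfolding border_rank_le_def by (simp add: closure_def)

lemma border_rank_le_mono: "border_rank_le r T \<Longrightarrow> r \<le> q \<Longrightarrow> border_rank_le q T"
  unfolding border_rank_le_def
  using closure_mono[of "{S. rank_le r S}" "{S. rank_le q S}"] rank_le_mono by auto

text \<open>
  All transfers from rank to border rank are instances of this: a map that is continuous in each
  coordinate sends the closure into the closure.
\<close>

lemma border_rank_le_image:
  assumes T: "border_rank_le r T"
    and F: "\<And>S. rank_le r S \<Longrightarrow> border_rank_le q (F S)"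
    and cont: "\<And>x. continuous_on UNIV (\<lambda>S. F S x)"
  shows "border_rank_le q (F T)"
proof -
  have "continuous_on (closure {S. rank_le r S}) F"
    by (intro continuous_on_coordinatewise_then_product continuous_on_subset[OF cont]) simp
  then have "F ` closure {S. rank_le r S} \<subseteq> closure {S. rank_le q S}"
    by (rule image_closure_subset) (use F in \<open>auto simp: border_rank_le_def\<close>)
  with T show ?thesis unfolding border_rank_le_def by blast
qed

lemma border_rank_le_substitute:
  fixes \<alpha> :: "'a \<Rightarrow> 'a2 \<Rightarrow> complex" and \<beta> :: "'b \<Rightarrow> 'b2 \<Rightarrow> complex"
    and \<gamma> :: "'c \<Rightarrow> 'c2 \<Rightarrow> complex" and \<delta> :: "'d \<Rightarrow> 'd2 \<Rightarrow> complex"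
  assumes "border_rank_le r T"
  shows "border_rank_le r (\<lambda>(a, b, c, d). \<Sum>a'\<in>I a. \<Sum>b'\<in>J b. \<Sum>c'\<in>K c. \<Sum>d'\<in>L d.
           \<alpha> a a' * \<beta> b b' * \<gamma> c c' * \<delta> d d' * T (a', b', c', d'))"
proof (rule border_rank_le_image[OF assms, where F = "\<lambda>S (a, b, c, d).
    \<Sum>a'\<in>I a. \<Sum>b'\<in>J b. \<Sum>c'\<in>K c. \<Sum>d'\<in>L d.
      \<alpha> a a' * \<beta> b b' * \<gamma> c c' * \<delta> d d' * S (a', b', c', d')"])
  show "border_rank_le r (\<lambda>(a, b, c, d). \<Sum>a'\<in>I a. \<Sum>b'\<in>J b. \<Sum>c'\<in>K c. \<Sum>d'\<in>L d.
           \<alpha> a a' * \<beta> b b' * \<gamma> c c' * \<delta> d d' * S (a', b', c', d'))"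
    if "rank_le r S" for S
    by (rule border_rank_leI, rule rank_le_substitute, rule that)
next
  fix x :: "'a \<times> 'b \<times> 'c \<times> 'd"
  obtain a b c d where "x = (a, b, c, d)" by (metis prod.exhaust)
  then show "continuous_on UNIV (\<lambda>S. (\<lambda>(a, b, c, d). \<Sum>a'\<in>I a. \<Sum>b'\<in>J b. \<Sum>c'\<in>K c. \<Sum>d'\<in>L d.
           \<alpha> a a' * \<beta> b b' * \<gamma> c c' * \<delta> d d' * S (a', b', c', d')) x)"
    by (simp only: prod.case)
      (intro continuous_intros continuous_on_product_coordinates)
qed

lemma border_rank_le_pullback:
  assumes "border_rank_le r T"
  shows "border_rank_le r (\<lambda>(a, b, c, d).
           \<alpha> a * \<beta> b * \<gamma> c * \<delta> d * T (f a, g b, h c, k d))"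
  using border_rank_le_substitute[OF assms, where I = "\<lambda>a. {f a}" and J = "\<lambda>b. {g b}"
      and K = "\<lambda>c. {h c}" and L = "\<lambda>d. {k d}" and \<alpha> = "\<lambda>a _. \<alpha> a" and \<beta> = "\<lambda>b _. \<beta> b"
      and \<gamma> = "\<lambda>c _. \<gamma> c" and \<delta> = "\<lambda>d _. \<delta> d"]
  by simp

lemma border_rank_le_reindex:
  assumes "border_rank_le r T"
  shows "border_rank_le r (\<lambda>(a, b, c, d). T (f a, g b, h c, k d))"
  using border_rank_le_pullback[OF assms, of "\<lambda>_. 1" "\<lambda>_. 1" "\<lambda>_. 1" "\<lambda>_. 1" f g h k]
  by simp

lemma border_rank_le_mult:
  assumes T: "border_rank_le r T" and S: "border_rank_le q S"
  shows "border_rank_le (r * q) (\<lambda>x. T x * S x)"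
proof (rule border_rank_le_image[OF T, where F = "\<lambda>T x. T x * S x"])
  fix T' :: "'a \<times> 'b \<times> 'c \<times> 'd \<Rightarrow> complex" assume T': "rank_le r T'"
  show "border_rank_le (r * q) (\<lambda>x. T' x * S x)"
  proof (rule border_rank_le_image[OF S, where F = "\<lambda>S x. T' x * S x"])
    show "border_rank_le (r * q) (\<lambda>x. T' x * S' x)" if "rank_le q S'" for S'
      by (rule border_rank_leI[OF rank_le_mult[OF T' that]])
  qed (intro continuous_on_mult continuous_on_const continuous_on_product_coordinates)
qed (intro continuous_on_mult continuous_on_const continuous_on_product_coordinates)

text \<open>
  The \<open>N\<close>-th Kronecker power has sequences as indices. They are modelled by functions on \<open>nat\<close> of which only the
  values below \<open>N\<close> matter; the power is then a product of reindexings along evaluation maps.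
\<close>

lemma border_rank_le_power:
  assumes "border_rank_le r T"
  shows "border_rank_le (r ^ N) (\<lambda>(a, b, c, d). \<Prod>i<N. T (a i, b i, c i, d i))"
proof (induction N)
  case 0
  have "rank_le 1 (\<lambda>_ :: (nat \<Rightarrow> 'a) \<times> (nat \<Rightarrow> 'b) \<times> (nat \<Rightarrow> 'c) \<times> (nat \<Rightarrow> 'd). 1)"
    using rank_le_sum_indexed[of "{()}" 1 "\<lambda>_ _. 1" "\<lambda>_ _. 1" "\<lambda>_ _. 1" "\<lambda>_ _. 1"]
    by (simp add: tensor4_def case_prod_unfold)
  from border_rank_leI[OF this] show ?case
    by (simp add: case_prod_unfold)
next
  case (Suc N)
  have "border_rank_le r (\<lambda>(a :: nat \<Rightarrow> 'a, b :: nat \<Rightarrow> 'b, c :: nat \<Rightarrow> 'c, d :: nat \<Rightarrow> 'd).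
      T (a N, b N, c N, d N))"
    by (rule border_rank_le_reindex[OF assms])
  from border_rank_le_mult[OF Suc this] show ?case
    by (simp add: case_prod_unfold mult_ac)
qed

section \<open>Comparison with the least-number definition\<close>

text \<open>
  Countable index types make the product topology first countable, so that the closure is reached by
  sequences. Multiplication by the indicator of the coordinate space puts the sequence into that space
  without changing its limit. Since \<open>border_rank\<close> asks for a sequence of constant rank, a subsequence is
  chosen on which the rank, bounded by \<open>r\<close>, takes the same value.
\<close>

lemma border_rank_le_imp_border_rank:
  fixes A :: "'a :: countable set" and B :: "'b :: countable set"
    and C :: "'c :: countable set" and D :: "'d :: countable set"
  assumes T: "border_rank_le r T" and supp: "T \<in> coord_space (A \<times> B \<times> C \<times> D)"
  shows "border_rank A B C D T \<le> r"
proof -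
  obtain S where S: "\<And>n. rank_le r (S n)" "S \<longlonglongrightarrow> T"
    using T unfolding border_rank_le_def closure_sequential by auto
  define P :: "('a \<times> 'b \<times> 'c \<times> 'd \<Rightarrow> complex) \<Rightarrow> _"
    where "P = (\<lambda>U x. if x \<in> A \<times> B \<times> C \<times> D then U x else 0)"
  have P_T: "P T = T"
    using supp by (fastforce simp: P_def coord_space_def fun_eq_iff)
  have "continuous_on UNIV P"
  proof (rule continuous_on_coordinatewise_then_product)
    show "continuous_on UNIV (\<lambda>U. P U x)" for x
      by (cases "x \<in> A \<times> B \<times> C \<times> D")
        (simp_all only: P_def if_True if_False continuous_on_product_coordinates continuous_on_const)
  qed
  then have lim: "(\<lambda>n. P (S n)) \<longlonglongrightarrow> T"
    using S(2) continuous_on_tendsto_compose[of UNIV P S T sequentially] P_T by simp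
  have rank: "tensor_rank A B C D (P (S n)) \<le> r" for n
  proof -
    obtain u v w z where uvwz: "S n = (\<lambda>x. \<Sum>l<r. tensor4 (u l) (v l) (w l) (z l) x)"
      using S(1) unfolding rank_le_def by blast
    show ?thesis
      unfolding tensor_rank_def
    proof (rule Least_le, intro exI conjI allI impI)
      show "P (S n) = (\<lambda>x. \<Sum>l<r. tensor4 (\<lambda>i. if i \<in> A then u l i else 0)
          (\<lambda>i. if i \<in> B then v l i else 0) (\<lambda>i. if i \<in> C then w l i else 0)
          (\<lambda>i. if i \<in> D then z l i else 0) x)"
        by (auto simp: P_def uvwz tensor4_def fun_eq_iff)
    qed (auto simp: coord_space_def)
  qed
  have "finite (range (\<lambda>n. tensor_rank A B C D (P (S n))))"
    by (rule finite_subset[of _ "{..r}"]) (use rank in auto)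
  then obtain m where m: "infinite {n. tensor_rank A B C D (P (S n)) = tensor_rank A B C D (P (S m))}"
    using pigeonhole_infinite[of UNIV "\<lambda>n. tensor_rank A B C D (P (S n))"] by auto
  from infinite_enumerate[OF this] obtain \<phi> :: "nat \<Rightarrow> nat" where \<phi>: "strict_mono \<phi>"
    "\<And>n. tensor_rank A B C D (P (S (\<phi> n))) = tensor_rank A B C D (P (S m))"
    by blast
  have "border_rank A B C D T \<le> tensor_rank A B C D (P (S m))"
    unfolding border_rank_def
  proof (rule Least_le, intro exI[of _ "\<lambda>n. P (S (\<phi> n))"] conjI allI)
    show "P (S (\<phi> n)) \<in> coord_space (A \<times> B \<times> C \<times> D)" for n
      by (auto simp: P_def coord_space_def)
    show "(\<lambda>n. P (S (\<phi> n))) \<longlonglongrightarrow> T"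
      using LIMSEQ_subseq_LIMSEQ[OF lim \<phi>(1)] by (simp add: o_def)
  qed (rule \<phi>(2))
  with rank[of m] show ?thesis by simp
qed

section \<open>Direct sums of copies of EMaMu tensors\<close>

lemma sum_if_const: "(\<Sum>i\<in>A. if P then f i else 0) = (if P then sum f A else 0)"
  by simp

text \<open>
  The direct sum of copies of \<open>EMaMu\<close> labelled by \<open>T\<close>. Sets of arbitrary type take the place of
  intervals of numbers because Kronecker products and powers produce pairs and sets of positions as
  indices; only the cardinalities matter, by \<open>EMaMu_copies_card_mono\<close>.
\<close>

definition EMaMu_copies ::
  "'t set \<Rightarrow> 'n1 set \<Rightarrow> 'n2 set \<Rightarrow> 'n3 set \<Rightarrow> 'n4 set \<Rightarrow>
    ('t \<times> 'n1 \<times> 'n3) \<times> ('t \<times> 'n2 \<times> 'n3) \<times> ('t \<times> 'n4) \<times> ('t \<times> 'n1 \<times> 'n2 \<times> 'n4) \<Rightarrow> complex" where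
  "EMaMu_copies T N1 N2 N3 N4 = (\<lambda>((t1, x1, x3), (t2, y2, y3), (t3, w4), (t4, z1, z2, z4)).
     of_bool (t1 \<in> T \<and> t2 = t1 \<and> t3 = t1 \<and> t4 = t1 \<and>
       x1 \<in> N1 \<and> z1 = x1 \<and> y2 \<in> N2 \<and> z2 = y2 \<and> x3 \<in> N3 \<and> y3 = x3 \<and> w4 \<in> N4 \<and> z4 = w4))"

lemma EMaMu_copies_embed:
  assumes "border_rank_le r (EMaMu_copies T' N1' N2' N3' N4')"
    and "inj_on f T" "f ` T \<subseteq> T'" "inj_on f1 N1" "f1 ` N1 \<subseteq> N1'" "inj_on f2 N2" "f2 ` N2 \<subseteq> N2'"
    and "inj_on f3 N3" "f3 ` N3 \<subseteq> N3'" "inj_on f4 N4" "f4 ` N4 \<subseteq> N4'"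
  shows "border_rank_le r (EMaMu_copies T N1 N2 N3 N4)"
proof -
  have "EMaMu_copies T N1 N2 N3 N4 = (\<lambda>(a, b, c, d).
     of_bool (a \<in> T \<times> N1 \<times> N3) * of_bool (b \<in> T \<times> N2 \<times> N3) * of_bool (c \<in> T \<times> N4) *
     of_bool (d \<in> T \<times> N1 \<times> N2 \<times> N4) *
     EMaMu_copies T' N1' N2' N3' N4' (map_prod f (map_prod f1 f3) a, map_prod f (map_prod f2 f3) b,
       map_prod f f4 c, map_prod f (map_prod f1 (map_prod f2 f4)) d))"
    using assms(2-)
    by (auto simp: EMaMu_copies_def fun_eq_iff inj_on_eq_iff image_subset_iff)
  then show ?thesis
    using border_rank_le_pullback[OF assms(1)] by simp
qed

lemma EMaMu_copies_card_mono:
  assumes "border_rank_le r (EMaMu_copies T' N1' N2' N3' N4')"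
    and fin: "finite T" "finite T'" "finite N1" "finite N1'" "finite N2" "finite N2'"
      "finite N3" "finite N3'" "finite N4" "finite N4'"
    and card: "card T \<le> card T'" "card N1 \<le> card N1'" "card N2 \<le> card N2'"
      "card N3 \<le> card N3'" "card N4 \<le> card N4'"
  shows "border_rank_le r (EMaMu_copies T N1 N2 N3 N4)"
proof -
  from card_le_inj[OF fin(1,2) card(1)] obtain f0 where 0: "f0 ` T \<subseteq> T'" "inj_on f0 T" by blast
  from card_le_inj[OF fin(3,4) card(2)] obtain f1 where 1: "f1 ` N1 \<subseteq> N1'" "inj_on f1 N1" by blast
  from card_le_inj[OF fin(5,6) card(3)] obtain f2 where 2: "f2 ` N2 \<subseteq> N2'" "inj_on f2 N2" by blast
  from card_le_inj[OF fin(7,8) card(4)] obtain f3 where 3: "f3 ` N3 \<subseteq> N3'" "inj_on f3 N3" by blast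
  from card_le_inj[OF fin(9,10) card(5)] obtain f4 where 4: "f4 ` N4 \<subseteq> N4'" "inj_on f4 N4" by blast
  show ?thesis
    by (rule EMaMu_copies_embed[OF assms(1) 0(2,1) 1(2,1) 2(2,1) 3(2,1) 4(2,1)])
qed

definition copies_border_rank_le ::
  "nat \<Rightarrow> nat \<Rightarrow> nat \<Rightarrow> nat \<Rightarrow> nat \<Rightarrow> nat \<Rightarrow> bool" where
  "copies_border_rank_le r s n1 n2 n3 n4 \<longleftrightarrow>
     border_rank_le r (EMaMu_copies {..<s} {..<n1} {..<n2} {..<n3} {..<n4})"

lemma copies_border_rank_leI:
  assumes "border_rank_le r (EMaMu_copies T N1 N2 N3 N4)"
    and "finite T" "finite N1" "finite N2" "finite N3" "finite N4"
    and "s \<le> card T" "n1 \<le> card N1" "n2 \<le> card N2" "n3 \<le> card N3" "n4 \<le> card N4"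
  shows "copies_border_rank_le r s n1 n2 n3 n4"
  unfolding copies_border_rank_le_def
  by (rule EMaMu_copies_card_mono[OF assms(1)]) (use assms in auto)

lemma copies_border_rank_le_mono:
  assumes "copies_border_rank_le r' s' n1' n2' n3' n4'" "r' \<le> r"
    and "s \<le> s'" "n1 \<le> n1'" "n2 \<le> n2'" "n3 \<le> n3'" "n4 \<le> n4'"
  shows "copies_border_rank_le r s n1 n2 n3 n4"
  by (rule copies_border_rank_leI[OF border_rank_le_mono[OF
        assms(1)[unfolded copies_border_rank_le_def] assms(2)]]) (use assms in auto)

lemma unit_tensor_rank_le:
  "rank_le r (\<lambda>(a, b, c, d). of_bool (a < r \<and> b = a \<and> c = a \<and> d = a))"
proof -
  have "(\<lambda>(a, b, c, d). of_bool (a < r \<and> b = a \<and> c = a \<and> d = a)) =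
     (\<lambda>x. \<Sum>l<r. tensor4 (basis_vec l) (basis_vec l) (basis_vec l) (basis_vec l) x)"
  proof
    fix x :: "nat \<times> nat \<times> nat \<times> nat"
    obtain a b c d where x: "x = (a, b, c, d)" by (metis prod.exhaust)
    have "(\<Sum>l<r. tensor4 (basis_vec l) (basis_vec l) (basis_vec l) (basis_vec l) x)
       = (\<Sum>l<r. if l = a then of_bool (b = a \<and> c = a \<and> d = a) else 0)"
      by (rule sum.cong) (auto simp: x tensor4_def basis_vec_def)
    then show "(\<lambda>(a, b, c, d). of_bool (a < r \<and> b = a \<and> c = a \<and> d = a)) x
      = (\<Sum>l<r. tensor4 (basis_vec l) (basis_vec l) (basis_vec l) (basis_vec l) x)"
      by (simp add: x)
  qed
  then show ?thesis
    by (simp add: rank_le_sum_indexed)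
qed

text \<open>
  Copies of the one-element tensor form the unit tensor. This starts the induction in
  \<open>copies_border_rank_le_power\<close>.
\<close>

lemma copies_border_rank_le_unit: "copies_border_rank_le s s 1 1 1 1"
proof -
  have "EMaMu_copies {..<s} {..<1::nat} {..<1::nat} {..<1::nat} {..<1::nat} = (\<lambda>(a :: nat \<times> nat \<times> nat, b, c, d).
     of_bool (snd a = (0, 0)) * of_bool (snd b = (0, 0)) * of_bool (snd c = 0) *
     of_bool (snd d = (0, 0, 0)) *
     (\<lambda>(a, b, c, d). of_bool (a < s \<and> b = a \<and> c = a \<and> d = a)) (fst a, fst b, fst c, fst d))"
    by (auto simp: EMaMu_copies_def fun_eq_iff)
  then show ?thesis
    using border_rank_le_pullback[OF border_rank_leI[OF unit_tensor_rank_le]]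
    by (simp add: copies_border_rank_le_def)
qed

text \<open>
  A direct sum of \<open>q\<close> equal tensors is the Kronecker product with the unit tensor of rank \<open>q\<close>.
\<close>

lemma copies_border_rank_le_direct_sum:
  assumes "copies_border_rank_le r s n1 n2 n3 n4"
  shows "copies_border_rank_le (q * r) (q * s) n1 n2 n3 n4"
proof (rule copies_border_rank_leI)
  have eq: "EMaMu_copies ({..<q} \<times> {..<s}) {..<n1} {..<n2} {..<n3} {..<n4} = (\<lambda>x.
      (\<lambda>(a, b, c, d). (\<lambda>(a, b, c, d). of_bool (a < q \<and> b = a \<and> c = a \<and> d = a))
          (fst (fst a), fst (fst b), fst (fst c), fst (fst d))) x *
      (\<lambda>(a, b, c, d). EMaMu_copies {..<s} {..<n1} {..<n2} {..<n3} {..<n4}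
          (apfst snd a, apfst snd b, apfst snd c, apfst snd d)) x)"
    by (auto simp: EMaMu_copies_def fun_eq_iff)
  show "border_rank_le (q * r) (EMaMu_copies ({..<q} \<times> {..<s}) {..<n1} {..<n2} {..<n3} {..<n4})"
    unfolding eq
    by (intro border_rank_le_mult border_rank_le_reindex border_rank_leI[OF unit_tensor_rank_le]
        assms[unfolded copies_border_rank_le_def])
qed auto

section \<open>An asymptotic sum inequality\<close>

text \<open>
  Border rank \<open>r\<close> means that the \<open>s\<close> copies of the first tensor are limits of images, under linear
  maps of the factors, of the unit tensor with \<open>r\<close> terms. Taking the Kronecker product with the second tensor
  \<open>Y\<close> turns the unit tensor into \<open>r\<close> copies of \<open>Y\<close>, whose border rank is at most \<open>q\<close>.
\<close>

lemma copies_border_rank_le_compose: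
  assumes S: "copies_border_rank_le r s n1 n2 n3 n4"
    and Q: "copies_border_rank_le q r m1 m2 m3 m4"
  shows "copies_border_rank_le q s (n1 * m1) (n2 * m2) (n3 * m3) (n4 * m4)"
proof (rule copies_border_rank_leI)
  let ?X = "EMaMu_copies {..<s} {..<n1} {..<n2} {..<n3} {..<n4} :: _ \<Rightarrow> complex"
  let ?Y = "EMaMu_copies {()} {..<m1} {..<m2} {..<m3} {..<m4} :: _ \<Rightarrow> complex"
  define F where "F = (\<lambda>X :: (nat \<times> nat \<times> nat) \<times> (nat \<times> nat \<times> nat) \<times> (nat \<times> nat) \<times> nat \<times> nat \<times> nat \<times> nat
       \<Rightarrow> complex.
     (\<lambda>((t1, (x1, x1'), (x3, x3')), (t2, (y2, y2'), (y3, y3')), (t3, (w4, w4')),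
         (t4, (z1, z1'), (z2, z2'), (z4, z4'))).
       X ((t1, x1, x3), (t2, y2, y3), (t3, w4), (t4, z1, z2, z4)) *
       ?Y (((), x1', x3'), ((), y2', y3'), ((), w4'), ((), z1', z2', z4'))))"
  have F_X: "F ?X = EMaMu_copies {..<s} ({..<n1} \<times> {..<m1}) ({..<n2} \<times> {..<m2})
      ({..<n3} \<times> {..<m3}) ({..<n4} \<times> {..<m4})"
    by (auto simp: F_def EMaMu_copies_def fun_eq_iff)
  \<comment> \<open>It suffices to bound the border rank of F X for X of rank at most r, as F is continuous.\<close>
  have "border_rank_le q (F ?X)"
  proof (rule border_rank_le_image[OF S[unfolded copies_border_rank_le_def]])
    fix X :: "(nat \<times> nat \<times> nat) \<times> (nat \<times> nat \<times> nat) \<times> (nat \<times> nat) \<times> nat \<times> nat \<times> nat \<times> nat \<Rightarrow> complex"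
    assume "rank_le r X"
    then obtain u v w z where X: "X = (\<lambda>x. \<Sum>l<r. tensor4 (u l) (v l) (w l) (z l) x)"
      unfolding rank_le_def by blast
    let ?Z = "EMaMu_copies {..<r} {..<m1} {..<m2} {..<m3} {..<m4} :: _ \<Rightarrow> complex"
    have Z: "e * ?Z ((l1, x1', x3'), (l2, y2', y3'), (l3, w4'), (l4, z1', z2', z4')) =
        (if l2 = l1 then if l3 = l1 then if l4 = l1 then e *
          ?Y (((), x1', x3'), ((), y2', y3'), ((), w4'), ((), z1', z2', z4')) else 0 else 0 else 0)"
      if "l1 < r" for e l1 l2 l3 l4 x1' x3' y2' y3' w4' z1' z2' z4'
      using that by (auto simp: EMaMu_copies_def)
    \<comment> \<open>The unit tensor inside ?Z identifies the four summation labels, which recovers the rank-one decomposition of X.\<close>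
    have "F X = (\<lambda>(a, b, c, d).
       \<Sum>a'\<in>(\<lambda>l. case a of (t, (x1, x1'), (x3, x3')) \<Rightarrow> (l, x1', x3')) ` {..<r}.
       \<Sum>b'\<in>(\<lambda>l. case b of (t, (y2, y2'), (y3, y3')) \<Rightarrow> (l, y2', y3')) ` {..<r}.
       \<Sum>c'\<in>(\<lambda>l. case c of (t, (w4, w4')) \<Rightarrow> (l, w4')) ` {..<r}.
       \<Sum>d'\<in>(\<lambda>l. case d of (t, (z1, z1'), (z2, z2'), (z4, z4')) \<Rightarrow> (l, z1', z2', z4')) ` {..<r}.
         (case a of (t, (x1, x1'), (x3, x3')) \<Rightarrow> u (fst a') (t, x1, x3)) *
         (case b of (t, (y2, y2'), (y3, y3')) \<Rightarrow> v (fst b') (t, y2, y3)) *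
         (case c of (t, (w4, w4')) \<Rightarrow> w (fst c') (t, w4)) *
         (case d of (t, (z1, z1'), (z2, z2'), (z4, z4')) \<Rightarrow> z (fst d') (t, z1, z2, z4)) *
         ?Z (a', b', c', d'))"
      by (simp add: fun_eq_iff F_def X sum.reindex inj_on_def Z tensor4_def
          sum_distrib_right sum_if_const split: prod.splits cong: sum.cong_simp)
    then show "border_rank_le q (F X)"
      by (simp only: border_rank_le_substitute[OF Q[unfolded copies_border_rank_le_def]])
  next
    show "continuous_on UNIV (\<lambda>X. F X x)" for x
      unfolding F_def case_prod_unfold
      by (intro continuous_on_mult continuous_on_const continuous_on_product_coordinates)
  qed
  then show "border_rank_le q (EMaMu_copies {..<s} ({..<n1} \<times> {..<m1}) ({..<n2} \<times> {..<m2})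
      ({..<n3} \<times> {..<m3}) ({..<n4} \<times> {..<m4}))"
    unfolding F_X .
qed auto

text \<open>
  Suppose that \<open>s\<close> copies of \<open>X^j\<close> are available at cost \<open>q^j s\<close>. Then \<open>q s\<close> copies cost
  \<open>q\<close> times as much, and these include \<open>r\<close> copies, which pay for one further factor \<open>X\<close> by the
  preceding lemma. Keeping \<open>s\<close> copies throughout means that the division of \<open>r\<close> by \<open>s\<close> happens
  at every step.
\<close>

lemma copies_border_rank_le_power:
  assumes "copies_border_rank_le r s n1 n2 n3 n4" "r \<le> q * s"
  shows "copies_border_rank_le (q ^ j * s) s (n1 ^ j) (n2 ^ j) (n3 ^ j) (n4 ^ j)"
proof (induction j)
  case 0
  show ?case using copies_border_rank_le_unit[of s] by simp
next
  case (Suc j)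
  have "copies_border_rank_le (q * (q ^ j * s)) (q * s) (n1 ^ j) (n2 ^ j) (n3 ^ j) (n4 ^ j)"
    by (rule copies_border_rank_le_direct_sum[OF Suc])
  then have "copies_border_rank_le (q ^ Suc j * s) r (n1 ^ j) (n2 ^ j) (n3 ^ j) (n4 ^ j)"
    by (rule copies_border_rank_le_mono) (use assms(2) in auto)
  from copies_border_rank_le_compose[OF assms(1) this] show ?case
    by simp
qed

lemma EMaMu_border_rank_le_copies:
  assumes "copies_border_rank_le r 1 n1 n2 n3 n4"
  shows "EMaMu_border_rank n1 n2 n3 n4 \<le> r"
  unfolding EMaMu_border_rank_def
proof (rule border_rank_le_imp_border_rank)
  have E: "EMaMu n1 n2 n3 n4 = (\<lambda>((x1, x3), (y2, y3), w4, (z1, z2, z4)).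
      of_bool (x1 \<in> {1..n1} \<and> z1 = x1 \<and> y2 \<in> {1..n2} \<and> z2 = y2 \<and> x3 \<in> {1..n3} \<and> y3 = x3 \<and>
        w4 \<in> {1..n4} \<and> z4 = w4))"
  proof (rule ext, clarify)
    fix x1 x3 y2 y3 w4 z1 z2 z4 :: nat
    have "tensor4 (basis_vec (i1, i3)) (basis_vec (i2, i3)) (basis_vec i4) (basis_vec (i1, i2, i4))
        ((x1, x3), (y2, y3), w4, (z1, z2, z4)) =
      (if i1 = x1 then if i2 = y2 then if i3 = x3 then if i4 = w4
        then of_bool (y3 = x3 \<and> z1 = x1 \<and> z2 = y2 \<and> z4 = w4) else 0 else 0 else 0 else 0)"
      for i1 i2 i3 i4
      by (auto simp: tensor4_def basis_vec_def)
    then show "EMaMu n1 n2 n3 n4 ((x1, x3), (y2, y3), w4, (z1, z2, z4)) =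
      of_bool (x1 \<in> {1..n1} \<and> z1 = x1 \<and> y2 \<in> {1..n2} \<and> z2 = y2 \<and> x3 \<in> {1..n3} \<and> y3 = x3 \<and>
        w4 \<in> {1..n4} \<and> z4 = w4)"
      by (auto simp: EMaMu_def sum_if_const)
  qed
  then show "EMaMu n1 n2 n3 n4 \<in> coord_space (({1..n1} \<times> {1..n3}) \<times> ({1..n2} \<times> {1..n3}) \<times> {1..n4} \<times>
       ({1..n1} \<times> {1..n2} \<times> {1..n4}))"
    by (auto simp: coord_space_def)
  have "border_rank_le r (EMaMu_copies {()} {1..n1} {1..n2} {1..n3} {1..n4})"
    by (rule EMaMu_copies_card_mono[OF assms[unfolded copies_border_rank_le_def]]) auto
  from border_rank_le_pullback[OF this, of "\<lambda>_. 1" "\<lambda>_. 1" "\<lambda>_. 1" "\<lambda>_. 1" "Pair ()" "Pair ()" "Pair ()" "Pair ()"]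
  show "border_rank_le r (EMaMu n1 n2 n3 n4)"
    by (simp add: E EMaMu_copies_def case_prod_unfold)
qed

section \<open>One extra rank-one term pays for a second summand\<close>

text \<open>
  The direct sum \<open>EMaMu(2,2,1;a+2) \<oplus> EMaMu(1,1,a;1)\<close>, with one-element index sets omitted. The
  constructors \<open>Inl\<close> and \<open>Some\<close> mark the indices of the first summand, \<open>Inr\<close> and \<open>None\<close> those of
  the second.
\<close>

definition EMaMu_sum :: "nat \<Rightarrow> (bool + nat) \<times> (bool + nat) \<times> nat option \<times> (bool \<times> bool \<times> nat) option \<Rightarrow> complex" where
  "EMaMu_sum a = (\<lambda>(x, y, w, z). case (x, y, w, z) of
      (Inl i, Inl j, Some k, Some (i', j', k')) \<Rightarrow> of_bool (i' = i \<and> j' = j \<and> k' = k \<and> k < a + 2)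
    | (Inr r, Inr r', None, None) \<Rightarrow> of_bool (r < a \<and> r' = r)
    | _ \<Rightarrow> 0)"

text \<open>
  Write \<open>g k\<close>, \<open>u k\<close>, \<open>v k\<close> for \<open>weight\<close>, \<open>left_vec\<close>, \<open>right_vec\<close> at \<open>k < a + 2\<close>, with
  \<open>u k\<close> and \<open>v k\<close> vectors of length \<open>a\<close>. The degeneration needs \<open>\<Sum> g k = 0\<close>, \<open>\<Sum> g k u k = 0\<close>,
  \<open>\<Sum> g k v k = 0\<close>, and \<open>\<Sum> g k (u k \<otimes> v k)\<close> equal to the identity. For the bilinear form with diagonal
  matrix \<open>g\<close> on a space of dimension \<open>a + 2\<close>, the first condition says that the all-ones vector is
  isotropic; its orthogonal complement modulo the vector itself is nondegenerate of dimension \<open>a\<close>,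
  and the rows of \<open>u\<close> and \<open>v\<close> have to be dual bases of it. This is why \<open>a + 2\<close> values of \<open>k\<close> give
  a second summand of size \<open>a\<close>.

  In the solution chosen here \<open>u k\<close> and \<open>v k\<close> are the standard basis vectors for \<open>k < a\<close>. The
  last two indices balance the sums; as \<open>u (a + 1) = 0\<close> and \<open>v a = 0\<close>, they leave the tensor
  \<open>\<Sum> g k (u k \<otimes> v k)\<close> unchanged.
\<close>

definition weight :: "nat \<Rightarrow> nat \<Rightarrow> complex" where
  "weight a k = (if k = Suc a then - of_nat (a + 1) else 1)"

definition left_vec :: "nat \<Rightarrow> nat \<Rightarrow> nat \<Rightarrow> complex" where
  "left_vec a k r = (if r < a then if k < a then of_bool (k = r) else if k = a then - 1 else 0 else 0)"

definition right_vec :: "nat \<Rightarrow> nat \<Rightarrow> nat \<Rightarrow> complex" where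
  "right_vec a k r = (if r < a then if k < a then of_bool (k = r) else if k = a then 0
     else 1 / of_nat (a + 1) else 0)"

lemma weight_sums:
  "(\<Sum>k<a + 2. weight a k) = 0"
  "(\<Sum>k<a + 2. weight a k * left_vec a k r) = 0"
  "(\<Sum>k<a + 2. weight a k * right_vec a k r) = 0"
  "(\<Sum>k<a + 2. weight a k * left_vec a k r * right_vec a k r') = of_bool (r < a \<and> r' = r)"
proof -
  have ne: "(1 + of_nat a :: complex) \<noteq> 0"
    by (metis of_nat_Suc of_nat_neq_0)
  have sum: "(\<Sum>k<a + 2. f k) = (\<Sum>k<a. f k) + f a + f (Suc a)" for f :: "nat \<Rightarrow> complex"
    by simp
  show "(\<Sum>k<a + 2. weight a k) = 0"
    unfolding sum by (simp add: weight_def)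
  show "(\<Sum>k<a + 2. weight a k * left_vec a k r) = 0"
    unfolding sum by (simp add: weight_def left_vec_def of_bool_def)
  show "(\<Sum>k<a + 2. weight a k * right_vec a k r) = 0"
    unfolding sum using ne
    by (auto simp: weight_def right_vec_def of_bool_def divide_simps)
  show "(\<Sum>k<a + 2. weight a k * left_vec a k r * right_vec a k r') = of_bool (r < a \<and> r' = r)"
  proof -
    have "(\<Sum>k<a. weight a k * left_vec a k r * right_vec a k r')
        = (\<Sum>k<a. if k = r then of_bool (r < a \<and> r' = r) else 0)"
      by (rule sum.cong) (auto simp: weight_def left_vec_def right_vec_def)
    then show ?thesis
      unfolding sum by (auto simp: weight_def left_vec_def right_vec_def)
  qed
qed

definition sgn_bool :: "bool \<Rightarrow> complex" where
  "sgn_bool i = (if i then - 1 else 1)"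

text \<open>
  The term with label \<open>(i, j, k)\<close> is the product of the four factors below, with \<open>e\<close> the parameter of
  the degeneration and \<open>False\<close>, \<open>True\<close> the two values of the binary indices. The signs make the
  perturbations of the first factor cancel when summed over \<open>i\<close>, and those of the second when summed
  over \<open>j\<close>. The first factor is perturbed only for \<open>j = False\<close> and the third only for
  \<open>i = j = False\<close>. The product of the first two perturbations depends on \<open>i\<close> through its sign only,
  so it cancels against the unperturbed third factor. Products with the perturbed third factor
  come from \<open>i = j = False\<close> alone and are summed over \<open>k\<close> by \<open>weight_sums\<close>.
\<close>

definition first_factor :: "nat \<Rightarrow> complex \<Rightarrow> bool \<times> bool \<times> nat \<Rightarrow> bool + nat \<Rightarrow> complex" where
  "first_factor a e = (\<lambda>(i, j, k) x. case x of Inl i' \<Rightarrow> of_bool (i' = i)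
     | Inr r \<Rightarrow> if j then 0 else e * (sgn_bool i * left_vec a k r))"

definition second_factor :: "nat \<Rightarrow> complex \<Rightarrow> bool \<times> bool \<times> nat \<Rightarrow> bool + nat \<Rightarrow> complex" where
  "second_factor a e = (\<lambda>(i, j, k) y. case y of Inl j' \<Rightarrow> of_bool (j' = j)
     | Inr r \<Rightarrow> e * (sgn_bool j * right_vec a k r))"

definition third_factor :: "nat \<Rightarrow> complex \<Rightarrow> bool \<times> bool \<times> nat \<Rightarrow> nat option \<Rightarrow> complex" where
  "third_factor a e = (\<lambda>(i, j, k) w. case w of Some k' \<Rightarrow> of_bool (k' = k)
     | None \<Rightarrow> if i \<or> j then 0 else e * weight a k)"

definition fourth_factor :: "complex \<Rightarrow> bool \<times> bool \<times> nat \<Rightarrow> (bool \<times> bool \<times> nat) option \<Rightarrow> complex" where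
  "fourth_factor e = (\<lambda>l z. case z of Some l' \<Rightarrow> of_bool (l' = l) | None \<Rightarrow> 1 / e ^ 3)"

text \<open>
  In the terms indexed by \<open>l\<close>, the part of the fourth factor that is singular in \<open>e\<close> multiplies the sum of all
  perturbed products. Its order-zero part is the rank-one tensor \<open>(\<Sum> e_i) \<otimes> (\<Sum> e_j) \<otimes> (\<Sum> c_k)\<close>, where
  \<open>e_i\<close>, \<open>e_j\<close>, \<open>c_k\<close> are the basis vectors at \<open>Inl i\<close>, \<open>Inl j\<close>, \<open>Some k\<close>; the last term removes it.
\<close>

definition approximant :: "nat \<Rightarrow> complex
    \<Rightarrow> (bool + nat) \<times> (bool + nat) \<times> nat option \<times> (bool \<times> bool \<times> nat) option \<Rightarrow> complex" where
  "approximant a e = (\<lambda>x.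
     (\<Sum>l\<in>UNIV \<times> UNIV \<times> {..<a + 2}.
        tensor4 (first_factor a e l) (second_factor a e l) (third_factor a e l) (fourth_factor e l) x)
     + tensor4 (\<lambda>x. of_bool (isl x)) (\<lambda>y. of_bool (isl y))
         (\<lambda>w. case w of None \<Rightarrow> 0 | Some k \<Rightarrow> of_bool (k < a + 2))
         (\<lambda>z. case z of None \<Rightarrow> - 1 / e ^ 3 | Some _ \<Rightarrow> 0) x)"

lemma rank_le_approximant: "rank_le (4 * (a + 2) + 1) (approximant a e)"
  unfolding approximant_def
  by (intro rank_le_add rank_le_sum_indexed rank_le_tensor4) (auto simp: card_cartesian_product)

lemma approximant_sum:
  "approximant a e (x, y, w, z) =
    (\<Sum>i\<in>UNIV. \<Sum>j\<in>UNIV. \<Sum>k<a + 2. first_factor a e (i, j, k) x * second_factor a e (i, j, k) y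
        * third_factor a e (i, j, k) w * fourth_factor e (i, j, k) z)
     + of_bool (isl x) * of_bool (isl y) * (case w of None \<Rightarrow> 0 | Some k \<Rightarrow> of_bool (k < a + 2))
       * (case z of None \<Rightarrow> - 1 / e ^ 3 | Some _ \<Rightarrow> 0)"
proof -
  have "(\<Sum>l\<in>UNIV \<times> UNIV \<times> {..<n}. f l) = (\<Sum>i\<in>UNIV. \<Sum>j\<in>UNIV. \<Sum>k<n. f (i, j, k))"
    for f :: "bool \<times> bool \<times> nat \<Rightarrow> complex" and n
    by (simp add: sum.cartesian_product)
  then show ?thesis
    by (simp only: approximant_def tensor4_def prod.case)
qed

text \<open>
  On the part of the fourth space that belongs to the second summand the approximation is exact: every order
  below \<open>e ^ 3\<close> cancels by the choice of the vectors, and the cubic term divided by \<open>e ^ 3\<close> is the identity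
  matrix.
\<close>

lemma approximant_None:
  assumes "e \<noteq> 0"
  shows "approximant a e (x, y, w, None) = EMaMu_sum a (x, y, w, None)"
proof -
  have W: "(\<Sum>k<a + 2. c * weight a k) = 0"
    "(\<Sum>k<a + 2. c * weight a k * left_vec a k r * right_vec a k r') = c * of_bool (r < a \<and> r' = r)"
    "(\<Sum>k<a + 2. c * weight a k * left_vec a k r) = 0"
    "(\<Sum>k<a + 2. c * weight a k * right_vec a k r) = 0" for c r r'
    using weight_sums[of a] by (simp_all only: mult.assoc sum_distrib_left[symmetric]) simp_all
  note defs = approximant_sum EMaMu_sum_def first_factor_def second_factor_def third_factor_def
    fourth_factor_def sgn_bool_def UNIV_bool
  show ?thesis
  proof (cases x; cases y; cases w)
    fix i j assume x: "x = Inl i" "y = Inl j" "w = None"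
    show ?thesis using W(1)[of "e / e ^ 3"]
      by (cases i; cases j) (simp_all add: defs x
        del: sum.lessThan_Suc add_2_eq_Suc add_2_eq_Suc')
  next
    fix i j k assume "x = Inl i" "y = Inl j" "w = Some k"
    then show ?thesis
      by (cases i; cases j) (simp_all add: defs of_bool_def sum_divide_distrib[symmetric]
        del: sum.lessThan_Suc add_2_eq_Suc add_2_eq_Suc')
  next
    fix i r assume x: "x = Inl i" "y = Inr r" "w = None"
    show ?thesis using W(4)[of "e * e / e ^ 3" r]
      by (cases i) (simp_all add: defs x mult_ac
        del: sum.lessThan_Suc add_2_eq_Suc add_2_eq_Suc')
  next
    fix i r k assume x: "x = Inl i" "y = Inr r" "w = Some k"
    show ?thesis
      by (cases i) (simp_all add: defs x sum_negf sum.distrib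
        del: sum.lessThan_Suc add_2_eq_Suc add_2_eq_Suc')
  next
    fix i r assume x: "x = Inr r" "y = Inl i" "w = None"
    show ?thesis using W(3)[of "e * e / e ^ 3" r]
      by (cases i) (simp_all add: defs x mult_ac
        del: sum.lessThan_Suc add_2_eq_Suc add_2_eq_Suc')
  next
    fix i r k assume x: "x = Inr r" "y = Inl i" "w = Some k"
    show ?thesis
      by (cases i) (simp_all add: defs x sum_negf sum.distrib
        del: sum.lessThan_Suc add_2_eq_Suc add_2_eq_Suc')
  next
    fix r r' assume x: "x = Inr r" "y = Inr r'" "w = None"
    show ?thesis using W(2)[of "e * e * e / e ^ 3" r r'] assms
      by (simp_all add: defs x mult_ac power3_eq_cube
        del: sum.lessThan_Suc add_2_eq_Suc add_2_eq_Suc')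
  next
    fix r r' k assume x: "x = Inr r" "y = Inr r'" "w = Some k"
    show ?thesis
      by (simp_all add: defs x sum_negf sum.distrib
        del: sum.lessThan_Suc add_2_eq_Suc add_2_eq_Suc')
  qed
qed

text \<open>
  On the remaining part \<open>fourth_factor\<close> has no pole, so \<open>e = 0\<close> may be inserted, which leaves the
  unperturbed first summand.
\<close>

lemma approximant_Some_0: "approximant a 0 (x, y, w, Some z) = EMaMu_sum a (x, y, w, Some z)"
proof -
  obtain i j k where z: "z = (i, j, k)" by (metis prod.exhaust)
  let ?g = "first_factor a 0 z x * second_factor a 0 z y * third_factor a 0 z w"
  have F: "c * fourth_factor 0 (i', j', k') (Some z) =
      (if i' = i then if j' = j then if k' = k then c else 0 else 0 else 0)" for c i' j' k'
    by (simp add: fourth_factor_def z)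
  have "approximant a 0 (x, y, w, Some z) = (if k < a + 2 then ?g else 0)"
    unfolding approximant_sum F sum_if_const by (simp add: z
        del: sum.lessThan_Suc add_2_eq_Suc add_2_eq_Suc')
  then show ?thesis
    by (auto simp: EMaMu_sum_def first_factor_def second_factor_def third_factor_def z
        split: sum.split option.split)
qed

lemma approximant_Some_tendsto:
  "((\<lambda>e. approximant a e (x, y, w, Some z)) \<longlongrightarrow> approximant a 0 (x, y, w, Some z)) (at 0)"
proof -
  have "((\<lambda>e. first_factor a e l x) \<longlongrightarrow> first_factor a 0 l x) (at 0)"
    "((\<lambda>e. second_factor a e l y) \<longlongrightarrow> second_factor a 0 l y) (at 0)"
    "((\<lambda>e. third_factor a e l w) \<longlongrightarrow> third_factor a 0 l w) (at 0)" for l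
  proof -
    obtain i j k where l: "l = (i, j, k)" by (metis prod.exhaust)
    have scaled: "((\<lambda>e. e * c) \<longlongrightarrow> 0 * c) (at 0)" for c :: complex
      by (intro tendsto_intros)
    show "((\<lambda>e. first_factor a e l x) \<longlongrightarrow> first_factor a 0 l x) (at 0)"
      using scaled[of "sgn_bool i * left_vec a k r" for r]
      by (cases x; cases j) (simp_all add: first_factor_def l)
    show "((\<lambda>e. second_factor a e l y) \<longlongrightarrow> second_factor a 0 l y) (at 0)"
      using scaled[of "sgn_bool j * right_vec a k r" for r]
      by (cases y) (simp_all add: second_factor_def l)
    show "((\<lambda>e. third_factor a e l w) \<longlongrightarrow> third_factor a 0 l w) (at 0)"
      using scaled[of "weight a k"]
      by (cases w; cases "i \<or> j") (simp_all add: third_factor_def l)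
  qed
  then show ?thesis
    unfolding approximant_sum fourth_factor_def option.case
    by (intro tendsto_add tendsto_sum tendsto_mult tendsto_const)
qed

lemma border_rank_le_EMaMu_sum: "border_rank_le (4 * (a + 2) + 1) (EMaMu_sum a)"
proof -
  have lim: "((\<lambda>e. approximant a e x) \<longlongrightarrow> EMaMu_sum a x) (at 0)" for x
  proof -
    obtain x1 x2 x3 x4 where x: "x = (x1, x2, x3, x4)" by (metis prod.exhaust)
    show ?thesis
    proof (cases x4)
      case None
      have "eventually (\<lambda>e. approximant a e x = EMaMu_sum a x) (at 0)"
        by (auto simp: eventually_at_filter x None approximant_None)
      then show ?thesis by (simp add: tendsto_eventually)
    next
      case (Some z)
      then show ?thesis using approximant_Some_tendsto approximant_Some_0 by (simp add: x)
    qed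
  qed
  have "limitin (product_topology (\<lambda>_. euclidean) UNIV) (\<lambda>e. approximant a e) (EMaMu_sum a) (at 0)"
    unfolding limitin_componentwise using lim by simp
  then have lim_fun: "(approximant a \<longlongrightarrow> EMaMu_sum a) (at 0)"
    by (simp add: euclidean_product_topology)
  have "approximant a e \<in> closure {S. rank_le (4 * (a + 2) + 1) S}" for e
    using border_rank_leI[OF rank_le_approximant] unfolding border_rank_le_def .
  then have "eventually (\<lambda>e. approximant a e \<in> closure {S. rank_le (4 * (a + 2) + 1) S}) (at 0)"
    by (intro always_eventually allI)
  from Lim_in_closed_set[OF closed_closure this at_neq_bot lim_fun] show ?thesis
    unfolding border_rank_le_def .
qed

section \<open>Disjoint copies inside a Kronecker power\<close>

text \<open>
  Numbers below \<open>n ^ k\<close> are encoded by digits whose positions are the elements of a given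
  set of size \<open>k\<close>.
\<close>

lemma ex_digits:
  assumes "finite S" "card S = k"
  shows "\<exists>\<phi> :: nat \<Rightarrow> 'i \<Rightarrow> nat. (\<forall>x < n ^ k. \<forall>i\<in>S. \<phi> x i < n) \<and>
           (\<forall>x < n ^ k. \<forall>y < n ^ k. (\<forall>i\<in>S. \<phi> x i = \<phi> y i) \<longrightarrow> x = y)"
proof -
  have "card {..<n ^ k} \<le> card (PiE S (\<lambda>_. {..<n}))"
    using assms by (simp add: card_PiE)
  then obtain \<phi> where \<phi>: "\<phi> ` {..<n ^ k} \<subseteq> PiE S (\<lambda>_. {..<n})" "inj_on \<phi> {..<n ^ k}"
    using card_le_inj[of "{..<n ^ k}" "PiE S (\<lambda>_. {..<n})"] assms by (auto simp: finite_PiE)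
  show ?thesis
  proof (intro exI[of _ \<phi>] conjI allI impI ballI)
    show "\<phi> x i < n" if "x < n ^ k" "i \<in> S" for x i
      using \<phi>(1) that by (fastforce dest: PiE_mem)
    show "x = y" if "x < n ^ k" "y < n ^ k" "\<forall>i\<in>S. \<phi> x i = \<phi> y i" for x y
    proof -
      have "\<phi> x = \<phi> y" by (rule PiE_ext[of _ S "\<lambda>_. {..<n}"]) (use \<phi>(1) that in auto)
      then show ?thesis using \<phi>(2) that by (auto simp: inj_on_def)
    qed
  qed
qed

text \<open>
  The copies are labelled by the sets \<open>S\<close> of the \<open>k\<close> positions at which the first summand is taken. The indices
  of the copy \<open>S\<close> are the sequences that lie in the first summand exactly at the positions in \<open>S\<close>; if
  two of the four indices have different labels, then at some position they lie in different
  summands and the product vanishes. Inside one copy, the positions in \<open>S\<close> carry the digits of the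
  indices bounded by \<open>2 ^ k\<close> and \<open>(a + 2) ^ k\<close>, and the other positions those of the index
  bounded by \<open>a ^ l\<close>.
\<close>

lemma copies_border_rank_le_choose:
  "copies_border_rank_le ((4 * (a + 2) + 1) ^ (k + l)) ((k + l) choose k) (2 ^ k) (2 ^ k) (a ^ l) ((a + 2) ^ k)"
proof (rule copies_border_rank_leI)
  let ?N = "k + l"
  define \<S> where "\<S> = {S. S \<subseteq> {..<?N} \<and> card S = k}"
  have digits: "\<exists>\<phi> :: nat set \<Rightarrow> nat \<Rightarrow> nat \<Rightarrow> nat. \<forall>S\<in>\<S>. (\<forall>x < n ^ k. \<forall>i\<in>S. \<phi> S x i < n) \<and>
           (\<forall>x < n ^ k. \<forall>y < n ^ k. (\<forall>i\<in>S. \<phi> S x i = \<phi> S y i) \<longrightarrow> x = y)" for n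
    by (intro bchoice ballI ex_digits) (auto simp: \<S>_def finite_subset)
  have co_digits: "\<exists>\<phi> :: nat set \<Rightarrow> nat \<Rightarrow> nat \<Rightarrow> nat. \<forall>S\<in>\<S>.
       (\<forall>x < n ^ l. \<forall>i\<in>{..<?N} - S. \<phi> S x i < n) \<and>
       (\<forall>x < n ^ l. \<forall>y < n ^ l. (\<forall>i\<in>{..<?N} - S. \<phi> S x i = \<phi> S y i) \<longrightarrow> x = y)" for n
    by (intro bchoice ballI ex_digits) (auto simp: \<S>_def card_Diff_subset finite_subset)
  obtain \<beta> :: "nat set \<Rightarrow> nat \<Rightarrow> nat \<Rightarrow> nat" where
    \<beta>: "\<And>S x i. S \<in> \<S> \<Longrightarrow> x < 2 ^ k \<Longrightarrow> i \<in> S \<Longrightarrow> \<beta> S x i < 2"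
      "\<And>S x y. S \<in> \<S> \<Longrightarrow> x < 2 ^ k \<Longrightarrow> y < 2 ^ k \<Longrightarrow> (\<And>i. i \<in> S \<Longrightarrow> \<beta> S x i = \<beta> S y i) \<Longrightarrow> x = y"
    using digits[of 2] by metis
  obtain \<gamma> :: "nat set \<Rightarrow> nat \<Rightarrow> nat \<Rightarrow> nat" where
    \<gamma>: "\<And>S x i. S \<in> \<S> \<Longrightarrow> x < (a + 2) ^ k \<Longrightarrow> i \<in> S \<Longrightarrow> \<gamma> S x i < a + 2"
      "\<And>S x y. S \<in> \<S> \<Longrightarrow> x < (a + 2) ^ k \<Longrightarrow> y < (a + 2) ^ k \<Longrightarrow>
          (\<And>i. i \<in> S \<Longrightarrow> \<gamma> S x i = \<gamma> S y i) \<Longrightarrow> x = y"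
    using digits[of "a + 2"] by metis
  obtain \<alpha> :: "nat set \<Rightarrow> nat \<Rightarrow> nat \<Rightarrow> nat" where
    \<alpha>: "\<And>S x i. S \<in> \<S> \<Longrightarrow> x < a ^ l \<Longrightarrow> i < ?N \<Longrightarrow> i \<notin> S \<Longrightarrow> \<alpha> S x i < a"
      "\<And>S x y. S \<in> \<S> \<Longrightarrow> x < a ^ l \<Longrightarrow> y < a ^ l \<Longrightarrow>
          (\<And>i. i < ?N \<Longrightarrow> i \<notin> S \<Longrightarrow> \<alpha> S x i = \<alpha> S y i) \<Longrightarrow> x = y"
    using co_digits[of a] by (metis DiffI DiffE lessThan_iff)
  \<comment> \<open>The base-two digits are turned into truth values, the binary indices of the first summand.\<close>
  define \<beta>' where "\<beta>' = (\<lambda>S x i. \<beta> S x i = 1)"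
  have \<beta>': "x = y" if "S \<in> \<S>" "x < 2 ^ k" "y < 2 ^ k" "\<And>i. i \<in> S \<Longrightarrow> \<beta>' S x i = \<beta>' S y i" for S x y
  proof (rule \<beta>(2)[OF that(1-3)])
    fix i assume "i \<in> S"
    then show "\<beta> S x i = \<beta> S y i"
      using \<beta>(1)[OF that(1,2), of i] \<beta>(1)[OF that(1,3), of i] that(4)[of i]
      by (auto simp: \<beta>'_def less_2_cases_iff)
  qed
  define fA where "fA = (\<lambda>(S, x1, x3) i. if i \<in> S then Inl (\<beta>' S x1 i) else Inr (\<alpha> S x3 i))"
  define fC where "fC = (\<lambda>(S, x4) i. if i \<in> S then Some (\<gamma> S x4 i) else None)"
  define fD where "fD = (\<lambda>(S, x1, x2, x4) i. if i \<in> S then Some (\<beta>' S x1 i, \<beta>' S x2 i, \<gamma> S x4 i) else None)"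
  have prod: "(\<Prod>i<?N. EMaMu_sum a (fA (S1, x1, x3) i, fA (S2, y2, y3) i, fC (S3, w4) i, fD (S4, z1, z2, z4) i))
      = of_bool (S2 = S1 \<and> S3 = S1 \<and> S4 = S1 \<and> z1 = x1 \<and> z2 = y2 \<and> y3 = x3 \<and> z4 = w4)"
    if ran: "S1 \<in> \<S>" "S2 \<in> \<S>" "S3 \<in> \<S>" "S4 \<in> \<S>" "x1 < 2 ^ k" "z1 < 2 ^ k" "y2 < 2 ^ k" "z2 < 2 ^ k"
      "x3 < a ^ l" "y3 < a ^ l" "w4 < (a + 2) ^ k" "z4 < (a + 2) ^ k"
    for S1 S2 S3 S4 x1 x3 y2 y3 w4 z1 z2 z4
  proof (cases "S2 = S1 \<and> S3 = S1 \<and> S4 = S1 \<and> z1 = x1 \<and> z2 = y2 \<and> y3 = x3 \<and> z4 = w4")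
    case True
    then show ?thesis
      using ran by (auto intro!: prod.neutral simp: EMaMu_sum_def fA_def fC_def fD_def \<gamma>(1) \<alpha>(1)
          simp del: add_2_eq_Suc add_2_eq_Suc')
  next
    case False
    have sub: "S1 \<subseteq> {..<?N}" "S2 \<subseteq> {..<?N}" "S3 \<subseteq> {..<?N}" "S4 \<subseteq> {..<?N}"
      using ran by (auto simp: \<S>_def)
    have "\<exists>i<?N. EMaMu_sum a (fA (S1, x1, x3) i, fA (S2, y2, y3) i, fC (S3, w4) i, fD (S4, z1, z2, z4) i) = 0"
    proof (rule ccontr)
      assume "\<not> ?thesis"
      then have nz: "EMaMu_sum a (fA (S1, x1, x3) i, fA (S2, y2, y3) i, fC (S3, w4) i, fD (S4, z1, z2, z4) i) \<noteq> 0"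
        if "i < ?N" for i
        using that by blast
      have "(i \<in> S2 \<longleftrightarrow> i \<in> S1) \<and> (i \<in> S3 \<longleftrightarrow> i \<in> S1) \<and> (i \<in> S4 \<longleftrightarrow> i \<in> S1)" if "i < ?N" for i
        using nz[OF that] by (auto simp: EMaMu_sum_def fA_def fC_def fD_def split: if_splits)
      with sub have S: "S2 = S1" "S3 = S1" "S4 = S1" by (blast | auto)+
      have "\<beta>' S1 z1 i = \<beta>' S1 x1 i \<and> \<beta>' S1 z2 i = \<beta>' S1 y2 i \<and> \<gamma> S1 z4 i = \<gamma> S1 w4 i" if "i \<in> S1" for i
        using nz[of i] that sub by (auto simp: EMaMu_sum_def fA_def fC_def fD_def S)
      then have "z1 = x1" "z2 = y2" "z4 = w4"
        using \<beta>'[of S1 z1 x1] \<beta>'[of S1 z2 y2] \<gamma>(2)[of S1 z4 w4] ran by auto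
      moreover have "\<alpha> S1 y3 i = \<alpha> S1 x3 i" if "i < ?N" "i \<notin> S1" for i
        using nz[of i] that sub by (auto simp: EMaMu_sum_def fA_def fC_def fD_def S)
      then have "y3 = x3" using \<alpha>(2)[of S1 y3 x3] ran by auto
      ultimately show False using False S by simp
    qed
    then show ?thesis using False by (auto simp: prod_zero_iff)
  qed
  have "EMaMu_copies \<S> {..<2 ^ k :: nat} {..<2 ^ k :: nat} {..<a ^ l} {..<(a + 2) ^ k} = (\<lambda>(A, B, C, D).
     of_bool (A \<in> \<S> \<times> {..<2 ^ k} \<times> {..<a ^ l}) * of_bool (B \<in> \<S> \<times> {..<2 ^ k} \<times> {..<a ^ l}) *
     of_bool (C \<in> \<S> \<times> {..<(a + 2) ^ k}) * of_bool (D \<in> \<S> \<times> {..<2 ^ k} \<times> {..<2 ^ k} \<times> {..<(a + 2) ^ k}) *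
     (\<lambda>(A, B, C, D). \<Prod>i<?N. EMaMu_sum a (A i, B i, C i, D i)) (fA A, fA B, fC C, fD D))"
    by (auto simp: EMaMu_copies_def fun_eq_iff prod
        simp del: prod_zero_iff prod_eq_1_iff add_2_eq_Suc add_2_eq_Suc')
  then show "border_rank_le ((4 * (a + 2) + 1) ^ ?N)
     (EMaMu_copies \<S> {..<2 ^ k :: nat} {..<2 ^ k :: nat} {..<a ^ l} {..<(a + 2) ^ k})"
    by (simp only: border_rank_le_pullback[OF border_rank_le_power[OF border_rank_le_EMaMu_sum]])
  show "(k + l) choose k \<le> card \<S>"
    using n_subsets[of "{..<?N}" k] by (simp add: \<S>_def)
  show "finite \<S>"
    by (simp add: \<S>_def)
qed auto

section \<open>Choosing the Kronecker power\<close>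

text \<open>
  Let \<open>k\<close> be a mode of the binomial distribution. The largest of \<open>N + 1\<close> probabilities is at least
  \<open>1 / (N + 1)\<close>, and comparison with the two neighbouring terms places the mode within distance one of
  \<open>(N + 1) p\<close>. Together these give the entropy as the growth rate of \<open>N choose k\<close>.
\<close>

lemma ex_binomial_mode:
  fixes p :: real
  assumes p: "0 < p" "p < 1"
  obtains k l where "k + l = N" "real k \<le> (real N + 1) * p" "(real N + 1) * p \<le> real k + 1"
    "1 \<le> (real N + 1) * (real (N choose k) * p ^ k * (1 - p) ^ l)"
proof -
  define t where "t = (\<lambda>k. real (N choose k) * p ^ k * (1 - p) ^ (N - k))"
  obtain k where k: "k \<le> N" "\<And>j. j \<le> N \<Longrightarrow> t j \<le> t k"
  proof -
    have "finite (t ` {..N})" "t ` {..N} \<noteq> {}" by auto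
    then have "Max (t ` {..N}) \<in> t ` {..N}" by (rule Max_in)
    then obtain k where "k \<in> {..N}" "Max (t ` {..N}) = t k" by blast
    with that[of k] show ?thesis by (metis Max_ge \<open>finite (t ` {..N})\<close> atMost_iff imageI)
  qed
  have "1 = (p + (1 - p)) ^ N" by simp
  also have "\<dots> = (\<Sum>j\<le>N. t j)" unfolding t_def by (rule binomial_ring)
  also have "\<dots> \<le> (\<Sum>j\<le>N. t k)" by (rule sum_mono) (use k in auto)
  finally have one: "1 \<le> (real N + 1) * t k" by (simp add: add.commute)
  have ratio: "(real j + 1) * (1 - p) * t (Suc j) = real (N - j) * p * t j" if "j < N" for j
  proof -
    have "Suc j * (N choose Suc j) = (N - j) * (N choose j)"
      using binomial_absorb_comp[of N j] Suc_times_binomial_eq[of "N - 1" j] that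
      by (cases N) (auto simp: mult_ac)
    then have c: "(real j + 1) * real (N choose Suc j) = real (N - j) * real (N choose j)"
      by (metis of_nat_Suc of_nat_mult add.commute)
    have "N - j = Suc (N - Suc j)" using that by simp
    then have "(real j + 1) * (1 - p) * t (Suc j)
        = ((real j + 1) * real (N choose Suc j)) * p ^ Suc j * (1 - p) ^ (N - j)"
      by (simp add: t_def mult_ac)
    also have "\<dots> = real (N - j) * p * t j"
      unfolding c by (simp add: t_def mult_ac)
    finally show ?thesis .
  qed
  have tpos: "t j > 0" if "j \<le> N" for j
    using p that by (simp add: t_def)
  show ?thesis
  proof (rule that[of k "N - k"])
    show "k + (N - k) = N" using k by simp
    show "1 \<le> (real N + 1) * (real (N choose k) * p ^ k * (1 - p) ^ (N - k))"
      using one by (simp add: t_def)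
    show "real k \<le> (real N + 1) * p"
    proof (cases k)
      case 0 then show ?thesis using p by simp
    next
      case (Suc j)
      have "real (N - j) * p * t j = real k * (1 - p) * t k"
        using ratio[of j] k Suc by (simp add: add.commute)
      also have "\<dots> \<ge> real k * (1 - p) * t j"
        by (rule mult_left_mono) (use k Suc p in auto)
      finally have "real k * (1 - p) \<le> real (N - j) * p"
        using tpos[of j] k Suc by simp
      then show ?thesis using k Suc by (simp add: of_nat_diff algebra_simps)
    qed
    show "(real N + 1) * p \<le> real k + 1"
    proof (cases "k < N")
      case True
      have "real (N - k) * p * t k = (real k + 1) * (1 - p) * t (Suc k)"
        using ratio[OF True] by simp
      also have "\<dots> \<le> (real k + 1) * (1 - p) * t k"
        by (rule mult_left_mono) (use k True p in auto)
      finally have "real (N - k) * p \<le> (real k + 1) * (1 - p)"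
        using tpos[of k] k by simp
      then show ?thesis using k by (simp add: of_nat_diff algebra_simps)
    next
      case False
      then have "real N = real k" using k by simp
      then show ?thesis using p by (simp add: mult_left_le)
    qed
  qed
qed

text \<open>
  Here \<open>k\<close> is the mode for a large \<open>N = k + l\<close>. Then \<open>R ^ N / (N choose k)\<close> is the cost of one copy, and
  its logarithm divided by \<open>K\<close> comes close to the claimed exponent as \<open>K / N\<close> tends to \<open>p\<close>.
  The real number \<open>K\<close> is slightly smaller than \<open>k\<close>: since \<open>k\<close> may exceed \<open>p N\<close>, the ratio \<open>l / k\<close> may
  fall short of \<open>(1 - p) / p\<close>, whereas \<open>K = p N - 1 / (1 - p)\<close> stays below both \<open>k\<close> and
  \<open>l p / (1 - p)\<close>. The factor 2 absorbs rounding up of the quotient.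
\<close>

lemma ex_power_near_optimal:
  fixes p R \<epsilon> :: real
  assumes p: "0 < p" "p < 1" and \<epsilon>: "\<epsilon> > 0" and R: "R > 0"
  obtains k l K where "K > 0" "K \<le> real k" "(1 - p) / p * K \<le> real l"
    "log 2 (2 * R ^ (k + l) / real ((k + l) choose k)) \<le> (1 / p * (log 2 R - binary_entropy p) + \<epsilon>) * K"
proof -
  define H where "H = log 2 R - binary_entropy p"
  \<comment> \<open>The constant collects the rounding of k and l, the factor 2, and log 2 (N + 1) - log 2 N.\<close>
  define C where "C = 2 - (1 - p) * log 2 p - p * log 2 (1 - p)"
  have "(\<lambda>N. ln (real N) / real N / ln 2 + C / real N) \<longlonglongrightarrow> 0 / ln 2 + 0"
    by (intro tendsto_add tendsto_divide tendsto_const lim_ln_over_n lim_const_over_n) auto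
  then have log0: "(\<lambda>N. (log 2 (real N) + C) / real N) \<longlonglongrightarrow> 0"
    by (simp add: log_def add_divide_distrib divide_divide_eq_left mult.commute)
  have "(\<lambda>N. (H + (log 2 (real N) + C) / real N) / (p - (1 / (1 - p)) / real N))
      \<longlonglongrightarrow> (H + 0) / (p - 0)"
    using p by (intro tendsto_divide tendsto_add tendsto_diff tendsto_const log0 lim_const_over_n) auto
  then have "eventually (\<lambda>N. (H + (log 2 (real N) + C) / real N) / (p - (1 / (1 - p)) / real N) < H / p + \<epsilon>) sequentially"
    by (rule order_tendstoD) (use \<epsilon> in auto)
  moreover have "eventually (\<lambda>N. real N > 1 / (1 - p) / p) sequentially"
    using filterlim_real_sequentially unfolding filterlim_at_top_dense by blast
  then have "eventually (\<lambda>N. real N * p > 1 / (1 - p)) sequentially"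
    using p by (simp add: field_simps)
  moreover have "eventually (\<lambda>N. N > 0) sequentially" by (rule eventually_gt_at_top)
  ultimately have "eventually (\<lambda>N. (H + (log 2 (real N) + C) / real N) / (p - (1 / (1 - p)) / real N) < H / p + \<epsilon>
      \<and> real N * p > 1 / (1 - p) \<and> N > 0) sequentially"
    by eventually_elim auto
  then obtain N :: nat where N: "(H + (log 2 (real N) + C) / real N) / (p - (1 / (1 - p)) / real N) < H / p + \<epsilon>"
    "real N * p > 1 / (1 - p)" "N > 0"
    by (auto simp: eventually_sequentially)
  define K where "K = real N * p - 1 / (1 - p)"
  obtain k l where kl: "k + l = N" "real k \<le> (real N + 1) * p" "(real N + 1) * p \<le> real k + 1"
    "1 \<le> (real N + 1) * (real (N choose k) * p ^ k * (1 - p) ^ l)"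
    using ex_binomial_mode[OF p] by blast
  have inv: "1 \<le> 1 / (1 - p)" using p by simp
  show ?thesis
  proof (rule that[of K k l])
    show K0: "K > 0" using N by (simp add: K_def)
    show "K \<le> real k"
    proof -
      have "real N * p + p \<le> real k + 1" using kl(3) by (simp add: algebra_simps)
      then show ?thesis using inv p unfolding K_def by linarith
    qed
    have l: "real l = real N - real k" using kl(1) by simp
    have "(1 - p) / p * K = (1 - p) * real N - 1 / p"
      using p by (simp add: K_def field_simps)
    also have "\<dots> \<le> (1 - p) * real N - 1" using p by simp
    also have "\<dots> \<le> real l" using kl(2) p unfolding l by (simp add: algebra_simps)
    finally show "(1 - p) / p * K \<le> real l" .
    have s0: "real (N choose k) > 0" using kl(1) by simp
    have "0 \<le> log 2 ((real N + 1) * (real (N choose k) * p ^ k * (1 - p) ^ l))"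
      using kl(4) by simp
    also have "\<dots> = log 2 (real N + 1) + log 2 (real (N choose k)) + real k * log 2 p + real l * log 2 (1 - p)"
      using p s0 by (simp add: log_mult log_nat_power)
    finally have s: "- log 2 (real (N choose k)) \<le> log 2 (real N + 1) + real k * log 2 p + real l * log 2 (1 - p)"
      by simp
    have lp: "log 2 p < 0" "log 2 (1 - p) < 0" using p by auto
    have "real k * log 2 p \<le> ((real N + 1) * p - 1) * log 2 p"
      by (rule mult_right_mono_neg) (use kl(3) lp in auto)
    moreover have "real l * log 2 (1 - p) \<le> (real N - (real N + 1) * p) * log 2 (1 - p)"
      by (rule mult_right_mono_neg) (use kl(2) lp l in auto)
    moreover have "log 2 (2 * R ^ N / real (N choose k)) = 1 + real N * log 2 R - log 2 (real (N choose k))"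
      using R s0 by (simp add: log_mult log_divide log_nat_power)
    moreover have "log 2 (real N + 1) \<le> 1 + log 2 (real N)"
    proof -
      have "log 2 (real N + 1) \<le> log 2 (2 * real N)" using N by (subst log_le_cancel_iff) auto
      then show ?thesis using N by (simp add: log_mult)
    qed
    ultimately have "log 2 (2 * R ^ N / real (N choose k)) \<le> real N * H + (log 2 (real N) + C)"
      using s by (simp add: H_def C_def binary_entropy_def algebra_simps)
    also have "\<dots> = real N * (H + (log 2 (real N) + C) / real N)"
      using N by (simp add: field_simps)
    also have "\<dots> \<le> real N * ((H / p + \<epsilon>) * (p - (1 / (1 - p)) / real N))"
    proof (rule mult_left_mono)
      have "p - (1 / (1 - p)) / real N = K / real N"
        using N(3) by (simp add: K_def diff_divide_distrib)
      then have "p - (1 / (1 - p)) / real N > 0" using K0 N by simp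
      then show "H + (log 2 (real N) + C) / real N \<le> (H / p + \<epsilon>) * (p - (1 / (1 - p)) / real N)"
        using N(1) by (simp only: pos_divide_less_eq less_imp_le)
    qed simp
    also have "\<dots> = (H / p + \<epsilon>) * K"
    proof -
      have "real N * (p - x / real N) = real N * p - x" for x
        using N(3) by (simp add: right_diff_distrib)
      then have "real N * (p - (1 / (1 - p)) / real N) = K"
        unfolding K_def .
      then show ?thesis by (metis mult.left_commute)
    qed
    finally show "log 2 (2 * R ^ (k + l) / real ((k + l) choose k))
      \<le> (1 / p * (log 2 R - binary_entropy p) + \<epsilon>) * K"
      by (simp add: kl(1) H_def)
  qed
qed

text \<open>
  With \<open>k\<close>, \<open>l\<close>, \<open>K\<close> fixed for the given \<open>\<epsilon>\<close>, the \<open>M\<close>-th power is covered by the \<open>j\<close>-th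
  power of one large tensor for \<open>j\<close> the least integer with \<open>K j \<ge> M\<close>. The maximum with 1 on the left side makes
  its logarithm nonnegative.
\<close>

lemma EMaMu_border_rank_growth:
  fixes a :: nat and p \<epsilon> :: real
  assumes p: "0 < p" "p < 1" and \<epsilon>: "\<epsilon> > 0" and a: "a \<ge> 1"
  defines "b \<equiv> 1 / p * (log 2 (4 * (real a + 2) + 1) - binary_entropy p)"
  obtains C where "C > 0"
    "\<And>M n3. real n3 \<le> real a powr ((1 - p) / p * real M) \<Longrightarrow>
       max 1 (real (EMaMu_border_rank (2 ^ M) (2 ^ M) n3 ((a + 2) ^ M))) \<le> C * 2 powr ((b + \<epsilon>) * real M)"
proof -
  define R where "R = 4 * (a + 2) + 1"
  have R: "real R = 4 * (real a + 2) + 1" by (simp add: R_def)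
  obtain k l K where K: "K > 0" "K \<le> real k" "(1 - p) / p * K \<le> real l"
    "log 2 (2 * real R ^ (k + l) / real ((k + l) choose k)) \<le> (b + \<epsilon>) * K"
  proof -
    have "real R > 0" by (simp add: R_def)
    from ex_power_near_optimal[OF p \<epsilon> this] show ?thesis
      using that unfolding b_def R by blast
  qed
  define s where "s = (k + l) choose k"
  \<comment> \<open>Rounding up the cost of a single copy; as R ^ (k + l) is at least s, this at most doubles the quotient.\<close>
  define q where "q = R ^ (k + l) div s + 1"
  have s0: "s > 0" by (simp add: s_def)
  have qs: "R ^ (k + l) \<le> q * s"
    using s0 by (simp add: q_def dividend_less_div_times less_imp_le)
  have "real s \<le> real R ^ (k + l)"
  proof -
    have "s \<le> 2 ^ (k + l)" unfolding s_def
      by (metis binomial_le_pow2)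
    also have "\<dots> \<le> R ^ (k + l)" by (rule power_mono) (auto simp: R_def)
    finally show ?thesis by (metis of_nat_le_iff of_nat_power)
  qed
  have "real q \<le> real R ^ (k + l) / real s + 1"
  proof -
    have "real (R ^ (k + l) div s * s) \<le> real (R ^ (k + l))"
      by (simp only: of_nat_le_iff div_times_less_eq_dividend)
    then show ?thesis using s0 by (simp add: q_def pos_le_divide_eq)
  qed
  also have "\<dots> \<le> 2 * real R ^ (k + l) / real s"
    using \<open>real s \<le> _\<close> s0 by (simp add: field_simps)
  finally have q2: "real q \<le> 2 * real R ^ (k + l) / real s" .
  have q1: "real q \<ge> 1" by (simp add: q_def)
  have qK: "log 2 (real q) \<le> (b + \<epsilon>) * K"
  proof -
    have "log 2 (real q) \<le> log 2 (2 * real R ^ (k + l) / real s)"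
      using q1 q2 by (subst log_le_cancel_iff) auto
    with K(4) show ?thesis by (simp add: s_def)
  qed
  show ?thesis
  proof (rule that[of "real q * real s"])
    show "real q * real s > 0" using q1 s0 by simp
    fix M n3 :: nat assume n3: "real n3 \<le> real a powr ((1 - p) / p * real M)"
    define j where "j = nat \<lceil>real M / K\<rceil>"
    have j1: "real M / K \<le> real j" unfolding j_def by (rule real_nat_ceiling_ge)
    have j2: "real j \<le> real M / K + 1" unfolding j_def
      using K(1) by (simp add: of_nat_nat ceiling_le_iff)
    have MK: "real M \<le> K * real j" using j1 K(1) by (simp add: field_simps)
    have Mk: "M \<le> k * j"
    proof -
      have "K * real j \<le> real k * real j" by (rule mult_right_mono) (use K in auto)
      with MK have "real M \<le> real (k * j)" by simp
      then show ?thesis by (simp only: of_nat_le_iff)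
    qed
    have "(1 - p) / p * real M \<le> (1 - p) / p * (K * real j)"
      by (rule mult_left_mono) (use MK p in auto)
    also have "\<dots> = ((1 - p) / p * K) * real j" by simp
    also have "\<dots> \<le> real l * real j" by (rule mult_right_mono) (use K in auto)
    finally have "real a powr ((1 - p) / p * real M) \<le> real a powr (real l * real j)"
      using a by (intro powr_mono) auto
    also have "\<dots> = real ((a ^ l) ^ j)"
      using a by (simp add: powr_realpow[symmetric] powr_powr)
    finally have n3': "n3 \<le> (a ^ l) ^ j"
      using n3 by (metis of_nat_le_iff order_trans)
    have "copies_border_rank_le (R ^ (k + l)) s (2 ^ k) (2 ^ k) (a ^ l) ((a + 2) ^ k)"
      unfolding s_def R_def by (rule copies_border_rank_le_choose)
    then have "copies_border_rank_le (q ^ j * s) s ((2 ^ k) ^ j) ((2 ^ k) ^ j) ((a ^ l) ^ j) (((a + 2) ^ k) ^ j)"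
      using qs by (rule copies_border_rank_le_power)
    then have "copies_border_rank_le (q ^ j * s) 1 (2 ^ M) (2 ^ M) n3 ((a + 2) ^ M)"
    proof (rule copies_border_rank_le_mono)
      show "(2::nat) ^ M \<le> (2 ^ k) ^ j" "(2::nat) ^ M \<le> (2 ^ k) ^ j" "(a + 2) ^ M \<le> ((a + 2) ^ k) ^ j"
        unfolding power_mult[symmetric] by (rule power_increasing; use Mk in simp)+
    qed (use n3' s0 in auto)
    then have "EMaMu_border_rank (2 ^ M) (2 ^ M) n3 ((a + 2) ^ M) \<le> q ^ j * s"
      by (rule EMaMu_border_rank_le_copies)
    moreover have "1 \<le> q ^ j * s" using q1 s0 by simp
    ultimately have "max 1 (real (EMaMu_border_rank (2 ^ M) (2 ^ M) n3 ((a + 2) ^ M))) \<le> real (q ^ j * s)"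
      by (metis max.bounded_iff of_nat_1 of_nat_le_iff)
    also have "\<dots> = real q powr real j * real s"
      using q1 by (simp add: powr_realpow)
    also have "\<dots> \<le> real q powr (real M / K + 1) * real s"
      using j2 q1 by (intro mult_right_mono powr_mono) auto
    also have "\<dots> = real q * real s * real q powr (real M / K)"
      using q1 by (simp add: powr_add)
    also have "real q powr (real M / K) = 2 powr (log 2 (real q) * (real M / K))"
      using q1 powr_powr[of 2 "log 2 (real q)" "real M / K"] by simp
    also have "real q * real s * \<dots> \<le> real q * real s * 2 powr ((b + \<epsilon>) * K * (real M / K))"
      using qK K(1) by (intro mult_left_mono powr_mono mult_right_mono) auto
    also have "(b + \<epsilon>) * K * (real M / K) = (b + \<epsilon>) * real M"
      using K(1) by simp
    finally show "max 1 (real (EMaMu_border_rank (2 ^ M) (2 ^ M) n3 ((a + 2) ^ M)))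
        \<le> real q * real s * 2 powr ((b + \<epsilon>) * real M)" .
  qed
qed

lemma EMaMu_border_rank_empty: "EMaMu_border_rank n1 n2 0 n4 = 0"
proof -
  have "rank_le 0 (EMaMu_copies {..<1::nat} {..<n1} {..<n2} {..<0::nat} {..<n4})"
    by (auto simp: rank_le_def EMaMu_copies_def fun_eq_iff)
  then have "copies_border_rank_le 0 1 n1 n2 0 n4"
    unfolding copies_border_rank_le_def by (rule border_rank_leI)
  then show ?thesis using EMaMu_border_rank_le_copies by blast
qed

theorem theorem4p1:
  fixes a :: nat and p :: real
  assumes "0 < p" and "p < 1"
  shows "EMaMu_omega_le 2 2 (real a powr ((1 - p) / p)) (real a + 2)
           (1 / p * (log 2 (4 * (real a + 2) + 1) - binary_entropy p))"
proof (cases "a = 0")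
  case True
  \<comment> \<open>For a = 0 the third weight is 0, so all tensors vanish.\<close>
  show ?thesis
    unfolding EMaMu_omega_le_def
    by (intro exI[of _ "\<lambda>_. 0"]) (auto simp: True EMaMu_border_rank_empty zero_power)
next
  case False
  define b where "b = 1 / p * (log 2 (4 * (real a + 2) + 1) - binary_entropy p)"
  define n3 where "n3 = (\<lambda>M. nat \<lfloor>(real a powr ((1 - p) / p)) ^ M\<rfloor>)"
  define B where "B = (\<lambda>M. max 1 (real (EMaMu_border_rank (2 ^ M) (2 ^ M) (n3 M) ((a + 2) ^ M))))"
  \<comment> \<open>The error term is the excess of the logarithm over the main term. It is sublinear because the growth bound holds for every epsilon.\<close>
  define f where "f = (\<lambda>M. max 0 (log 2 (B M) - b * real M))"
  have n3: "real (n3 M) \<le> real a powr ((1 - p) / p * real M)" for M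
  proof -
    have "(real a powr ((1 - p) / p)) ^ M = real a powr ((1 - p) / p * real M)"
      using False by (simp add: powr_realpow[symmetric] powr_powr)
    then show ?thesis by (simp add: n3_def)
  qed
  have B1: "B M \<ge> 1" for M by (simp add: B_def)
  have "f \<in> o(\<lambda>M. real M)"
  proof (rule landau_o.smallI)
    fix c :: real assume c: "c > 0"
    obtain C where C: "C > 0" "\<And>M. B M \<le> C * 2 powr ((b + c / 2) * real M)"
      using EMaMu_border_rank_growth[OF assms, of "c / 2" a] c False n3 unfolding B_def b_def
      by (metis One_nat_def Suc_leI half_gt_zero not_gr_zero)
    have "eventually (\<lambda>M. 2 * log 2 C / c < real M) sequentially"
      using filterlim_real_sequentially unfolding filterlim_at_top_dense by blast
    then have "eventually (\<lambda>M. log 2 C \<le> c / 2 * real M) sequentially"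
      by eventually_elim (use c in \<open>simp add: field_simps\<close>)
    then show "eventually (\<lambda>M. norm (f M) \<le> c * norm (real M)) sequentially"
    proof eventually_elim
      case (elim M)
      have "log 2 (B M) \<le> log 2 (C * 2 powr ((b + c / 2) * real M))"
        using B1[of M] C by (subst log_le_cancel_iff) auto
      also have "\<dots> = log 2 C + (b + c / 2) * real M"
        using C(1) by (simp add: log_mult)
      finally show ?case using elim c by (simp add: f_def algebra_simps)
    qed
  qed
  moreover have "real (EMaMu_border_rank (nat \<lfloor>2 ^ M :: real\<rfloor>) (nat \<lfloor>2 ^ M :: real\<rfloor>) (n3 M)
      (nat \<lfloor>(real a + 2) ^ M\<rfloor>)) \<le> 2 powr (b * real M + f M)" for M
  proof -
    have "(2::real) ^ M = real (2 ^ M)" "(real a + 2) ^ M = real ((a + 2) ^ M)"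
      by (auto simp: add.commute)
    then have "real (EMaMu_border_rank (nat \<lfloor>2 ^ M :: real\<rfloor>) (nat \<lfloor>2 ^ M :: real\<rfloor>) (n3 M)
      (nat \<lfloor>(real a + 2) ^ M\<rfloor>)) \<le> B M"
      unfolding B_def by (simp only: floor_of_nat nat_int max.cobounded2)
    also have "\<dots> = 2 powr log 2 (B M)" using B1[of M] by simp
    also have "\<dots> \<le> 2 powr (b * real M + f M)" by (intro powr_mono) (auto simp: f_def)
    finally show ?thesis .
  qed
  ultimately show ?thesis
    unfolding EMaMu_omega_le_def b_def n3_def by blast
qed

end
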